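(* Let $0\le s\le p$. Let $x_n^\delta$ be the regularized solution with $\sigma_n$ chosen by $$\sigma_n^{-1}=\frac{\delta^2}{E^2}\Big[\psi_p^{-1}\Big(\frac{\delta}{mE}\Big)\Big]^{2(s-p)} .$$ Assume that there is a constant $m>0$ with $m\|\varrho(G)x\|\le\|Ax\|$ for all $x\in X$, and that $x^\dagger-x_0=G^pv$ with $v\in X$, $\|v\|\le E$, for some positive constants $p,E$. If $h^2$ is operator monotone, $h(t)/\sqrt t$ is decreasing and $\xi_s(t):=\psi_s^2(t^{1/(2s)})$ is convex, then $$\|x_n^\delta-x^\dagger\|\le 2E\Big[\psi_p^{-1}\Big(\frac{\delta}{mE}\Big)\Big]^p .$$
   Context: Setting. $X,Y$ are Hilbert spaces; $A\in\mathcal L(X,Y)$ is linear, injective and bounded with non-closed range; $y\in\mathcal R(A)$, $x^\dagger\in X$ is the unique solution of $Ax=y$, and $y^\delta\in Y$ satisfies $\|y-y^\delta\|\le\delta$; $x_0\in X$ is a starting value. $B:\mathcal D(B)\subset X\to X$ is an unbounded densely defined self-adjoint strictly positive definite operator, $G:=B^{-1}$ (bounded, linear, injective, self-adjoint, with non-closed range), $a:=\|G\|$. Method. $T:=AG^s$, $\alpha_1,\dots,\alpha_n>0$, $\sigma_n:=\sum_{k=1}^n1/\alpha_k$ (the regularization parameter), and $$x_n^\delta:=x_0+G^sg_n(T^*T)T^*(y^\delta-Ax_0),\qquad g_n(\lambda)=\frac1\lambda\Big(1-\prod_{k=1}^n\frac{\alpha_k}{\lambda+\alpha_k}\Big).$$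 Functions. An index function is a continuous, strictly increasing function $(0,a]\to(0,b]$ with limit $0$ at $0+$. $\varrho:(0,a]\to(0,b]$ is an index function with $a=\|G\|$, $b=\varrho(a)$. $\psi_r(\lambda):=\lambda^r\varrho(\lambda)$, $\psi_r:(0,a]\to(0,a^r\varrho(a)]$, for constants $r$ for which $\lambda^r\varrho(\lambda)$ is monotonically increasing. $h(t):=[\psi_s^{-1}(\sqrt t)]^{p-s}$. An index function $f$ on an interval $(0,c]$ is operator monotone if for any pair of self-adjoint linear operators $S_1,S_2$ with spectra in $(0,c]$, $S_1\le S_2$ implies $f(S_1)\le f(S_2)$; here $S_1\le S_2$ means $(S_1x,x)\le(S_2x,x)$ for all $x\in X$. *)

theory Defs
  imports "HOL-Analysis.Analysis" "HOL-Computational_Algebra.Polynomial"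
begin

text \<open>Hilbert spaces are types of class \<open>real_inner\<close> and \<open>banach\<close>; bounded linear operators are
  elements of the library type of \<open>blinfun\<close>s with the operator norm. Scalars are real; a complex
  Hilbert space is a real one under the real part of its inner product, with the same norm.\<close>

subsection \<open>Operators on Hilbert spaces\<close>

definition hadjoint ::
  "('x::{real_inner,banach} \<Rightarrow>\<^sub>L 'y::{real_inner,banach}) \<Rightarrow> ('y \<Rightarrow>\<^sub>L 'x)"
  where "hadjoint T = Blinfun (adjoint (blinfun_apply T))"

definition selfadjoint_bounded :: "('x::{real_inner,banach} \<Rightarrow>\<^sub>L 'x) \<Rightarrow> bool"
  where "selfadjoint_bounded S \<longleftrightarrow> (\<forall>x y. S x \<bullet> y = x \<bullet> S y)"

definition op_le :: "('x::{real_inner,banach} \<Rightarrow>\<^sub>L 'x) \<Rightarrow> ('x \<Rightarrow>\<^sub>L 'x) \<Rightarrow> bool"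
  where "op_le S\<^sub>1 S\<^sub>2 \<longleftrightarrow> (\<forall>x. S\<^sub>1 x \<bullet> x \<le> S\<^sub>2 x \<bullet> x)"

text \<open>The spectrum is taken over the reals, which loses nothing for self-adjoint operators.\<close>

definition op_spectrum :: "('x::{real_inner,banach} \<Rightarrow>\<^sub>L 'x) \<Rightarrow> real set"
  where "op_spectrum S =
    {l. \<not> (\<exists>R. R o\<^sub>L (S - l *\<^sub>R id_blinfun) = id_blinfun \<and>
               (S - l *\<^sub>R id_blinfun) o\<^sub>L R = id_blinfun)}"

text \<open>A linear operator \<open>B\<close> with domain \<open>D\<close>; the values of \<open>B\<close> outside \<open>D\<close> are irrelevant.
  Self-adjointness is equality with the adjoint, domains included.\<close>

definition linear_operator :: "'x::{real_inner,banach} set \<Rightarrow> ('x \<Rightarrow> 'x) \<Rightarrow> bool"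
  where "linear_operator D B \<longleftrightarrow> subspace D \<and>
    (\<forall>x\<in>D. \<forall>z\<in>D. B (x + z) = B x + B z) \<and> (\<forall>c. \<forall>x\<in>D. B (c *\<^sub>R x) = c *\<^sub>R B x)"

definition adjoint_domain :: "'x::{real_inner,banach} set \<Rightarrow> ('x \<Rightarrow> 'x) \<Rightarrow> 'x set"
  where "adjoint_domain D B = {z. \<exists>w. \<forall>x\<in>D. B x \<bullet> z = x \<bullet> w}"

definition densely_defined_selfadjoint :: "'x::{real_inner,banach} set \<Rightarrow> ('x \<Rightarrow> 'x) \<Rightarrow> bool"
  where "densely_defined_selfadjoint D B \<longleftrightarrow> linear_operator D B \<and> closure D = UNIV \<and>
    adjoint_domain D B = D \<and> (\<forall>x\<in>D. \<forall>z\<in>D. B x \<bullet> z = x \<bullet> B z)"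

definition unbounded_on :: "'x::{real_inner,banach} set \<Rightarrow> ('x \<Rightarrow> 'x) \<Rightarrow> bool"
  where "unbounded_on D B \<longleftrightarrow> \<not> (\<exists>C. \<forall>x\<in>D. norm (B x) \<le> C * norm x)"

definition strictly_positive_definite :: "'x::{real_inner,banach} set \<Rightarrow> ('x \<Rightarrow> 'x) \<Rightarrow> bool"
  where "strictly_positive_definite D B \<longleftrightarrow> (\<exists>\<gamma>>0. \<forall>x\<in>D. \<gamma> * (norm x)\<^sup>2 \<le> B x \<bullet> x)"

definition is_inverse_operator ::
  "'x::{real_inner,banach} set \<Rightarrow> ('x \<Rightarrow> 'x) \<Rightarrow> ('x \<Rightarrow>\<^sub>L 'x) \<Rightarrow> bool"
  where "is_inverse_operator D B G \<longleftrightarrow>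
    (\<forall>x. G x \<in> D \<and> B (G x) = x) \<and> (\<forall>u\<in>D. G (B u) = u)"

subsection \<open>Continuous functional calculus of a bounded self-adjoint operator\<close>

definition poly_op :: "real poly \<Rightarrow> ('x::{real_inner,banach} \<Rightarrow>\<^sub>L 'x) \<Rightarrow> ('x \<Rightarrow>\<^sub>L 'x)"
  where "poly_op P S = (\<Sum>i\<le>degree P. coeff P i *\<^sub>R (((o\<^sub>L) S ^^ i) id_blinfun))"

text \<open>\<open>op_fun f S\<close> is \<open>f(S)\<close>: the norm limit of \<open>P\<^sub>k(S)\<close> for polynomials \<open>P\<^sub>k\<close> tending to \<open>f\<close>
  uniformly on the spectrum. It is meaningful for self-adjoint \<open>S\<close> and \<open>f\<close> continuous on the
  spectrum; the limit exists and does not depend on the choice of the \<open>P\<^sub>k\<close>.\<close>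

definition op_fun :: "(real \<Rightarrow> real) \<Rightarrow> ('x::{real_inner,banach} \<Rightarrow>\<^sub>L 'x) \<Rightarrow> ('x \<Rightarrow>\<^sub>L 'x)"
  where "op_fun f S = (THE F. \<forall>P. uniform_limit (op_spectrum S) (\<lambda>k. poly (P k)) f sequentially
            \<longrightarrow> (\<lambda>k. poly_op (P k) S) \<longlonglongrightarrow> F)"

text \<open>Real powers of a positive operator. The case \<open>s = 0\<close> is separate because \<open>0 powr 0 = 0\<close>
  in the library, whereas \<open>G\<^sup>0\<close> is the identity even when \<open>0\<close> is in the spectrum.\<close>

definition op_power :: "('x::{real_inner,banach} \<Rightarrow>\<^sub>L 'x) \<Rightarrow> real \<Rightarrow> ('x \<Rightarrow>\<^sub>L 'x)"
  where "op_power G s = op_fun (\<lambda>t. if s = 0 then 1 else t powr s) G"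

text \<open>An index function lives on \<open>(0, c]\<close>; to be applied to an operator with \<open>0\<close> in its spectrum
  it is continued by its limit \<open>0\<close>.\<close>

definition extend0 :: "(real \<Rightarrow> real) \<Rightarrow> real \<Rightarrow> real"
  where "extend0 f t = (if t \<le> 0 then 0 else f t)"

subsection \<open>Index functions and operator monotonicity\<close>

definition index_function :: "real \<Rightarrow> (real \<Rightarrow> real) \<Rightarrow> bool"
  where "index_function c f \<longleftrightarrow> f ` {0<..c} \<subseteq> {0<..f c} \<and> continuous_on {0<..c} f \<and>
    strict_mono_on {0<..c} f \<and> (f \<longlongrightarrow> 0) (at_right 0)"

text \<open>Operator monotonicity of \<open>f\<close> on \<open>(0, c]\<close>, over the Hilbert space given by the type argument.
  That \<open>f\<close> is an index function is not part of the definition, so that it also applies to the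
  constant function arising from \<open>s = p\<close>.\<close>

definition operator_monotone :: "'x::{real_inner,banach} itself \<Rightarrow> real \<Rightarrow> (real \<Rightarrow> real) \<Rightarrow> bool"
  where "operator_monotone _ c f \<longleftrightarrow>
    (\<forall>S\<^sub>1 S\<^sub>2 :: 'x \<Rightarrow>\<^sub>L 'x. selfadjoint_bounded S\<^sub>1 \<and> selfadjoint_bounded S\<^sub>2 \<and>
       op_spectrum S\<^sub>1 \<subseteq> {0<..c} \<and> op_spectrum S\<^sub>2 \<subseteq> {0<..c} \<and> op_le S\<^sub>1 S\<^sub>2
       \<longrightarrow> op_le (op_fun f S\<^sub>1) (op_fun f S\<^sub>2))"

definition psi :: "(real \<Rightarrow> real) \<Rightarrow> real \<Rightarrow> real \<Rightarrow> real"
  where "psi \<rho> r t = t powr r * \<rho> t"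

definition psi_inv :: "real \<Rightarrow> (real \<Rightarrow> real) \<Rightarrow> real \<Rightarrow> real \<Rightarrow> real"
  where "psi_inv a \<rho> r = the_inv_into {0<..a} (psi \<rho> r)"

definition h_fun :: "real \<Rightarrow> (real \<Rightarrow> real) \<Rightarrow> real \<Rightarrow> real \<Rightarrow> real \<Rightarrow> real"
  where "h_fun a \<rho> s p t = psi_inv a \<rho> s (sqrt t) powr (p - s)"

definition xi_fun :: "(real \<Rightarrow> real) \<Rightarrow> real \<Rightarrow> real \<Rightarrow> real"
  where "xi_fun \<rho> s t = (psi \<rho> s (t powr (1 / (2 * s))))\<^sup>2"

subsection \<open>The regularization method\<close>

definition sigma_sum :: "(nat \<Rightarrow> real) \<Rightarrow> nat \<Rightarrow> real"
  where "sigma_sum \<alpha> n = (\<Sum>k=1..n. 1 / \<alpha> k)"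

text \<open>At \<open>0\<close>, where the formula for \<open>g\<^sub>n\<close> has a removable singularity, the limit is used.\<close>

definition g_fun :: "(nat \<Rightarrow> real) \<Rightarrow> nat \<Rightarrow> real \<Rightarrow> real"
  where "g_fun \<alpha> n t =
    (if t = 0 then sigma_sum \<alpha> n else 1 / t * (1 - (\<Prod>k=1..n. \<alpha> k / (t + \<alpha> k))))"

definition regularized_solution ::
  "('x::{real_inner,banach} \<Rightarrow>\<^sub>L 'y::{real_inner,banach}) \<Rightarrow> ('x \<Rightarrow>\<^sub>L 'x) \<Rightarrow> real \<Rightarrow> (nat \<Rightarrow> real)
    \<Rightarrow> nat \<Rightarrow> 'x \<Rightarrow> 'y \<Rightarrow> 'x"
  where "regularized_solution A G s \<alpha> n x\<^sub>0 y\<^sub>\<delta> =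
    (let T = A o\<^sub>L op_power G s
     in x\<^sub>0 + op_power G s (op_fun (g_fun \<alpha> n) (hadjoint T o\<^sub>L T) (hadjoint T (y\<^sub>\<delta> - A x\<^sub>0))))"

end

theory Submission
  imports Defs "HOL-Computational_Algebra.Fundamental_Theorem_Algebra"
begin

text \<open>Put \<open>T = A G\<^sup>s\<close>, \<open>K = T\<^sup>*T\<close>, \<open>\<lambda> = \<psi>\<^sub>p\<^sup>-\<^sup>1(\<delta> / (m E))\<close> and \<open>h = \<lambda>\<^sup>p\<^sup>-\<^sup>s\<close>; the choice of \<open>\<sigma> = \<sigma>\<^sub>n\<close> says
  \<open>1 / \<sigma> = (m \<psi>\<^sub>s(\<lambda>))\<^sup>2\<close>. The error is \<open>G\<^sup>s z\<close> with \<open>z = g\<^sub>n(K) T\<^sup>* e - r\<^sub>n(K) G\<^sup>p\<^sup>-\<^sup>s v\<close>, where \<open>e\<close> is the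
  data noise and \<open>r\<^sub>n(t) = 1 - t g\<^sub>n(t) \<le> 1 / (1 + \<sigma> t)\<close>. Since \<open>h(t)\<close> increases and \<open>h(t) / \<surd>t\<close>
  decreases, \<open>t\<^sup>2\<^sup>(\<^sup>p\<^sup>-\<^sup>s\<^sup>) \<le> h\<^sup>2 (1 + \<psi>\<^sub>s(t)\<^sup>2 / \<psi>\<^sub>s(\<lambda>)\<^sup>2)\<close> on \<open>[0, a]\<close>, so the link condition gives
  \<open>G\<^sup>2\<^sup>(\<^sup>p\<^sup>-\<^sup>s\<^sup>) \<le> h\<^sup>2 (1 + \<sigma> K)\<close>: an affine majorant of \<open>h(t)\<^sup>2\<close>, for which monotonicity is trivial,
  carries the argument. It yields \<open>\<parallel>z\<parallel> \<le> 2 E h\<close> and \<open>\<parallel>T z\<parallel> \<le> 2 \<delta>\<close>, hence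
  \<open>\<parallel>\<psi>\<^sub>s(G) z\<parallel> \<le> 2 E h \<psi>\<^sub>s(\<lambda>)\<close>, and convexity of \<open>\<xi>\<^sub>s\<close> interpolates to
  \<open>\<parallel>G\<^sup>s z\<parallel> \<le> 2 E h \<lambda>\<^sup>s = 2 E \<lambda>\<^sup>p\<close>.\<close>

section \<open>Adjoints of bounded operators\<close>

text \<open>Direct method: the parallelogram law makes a minimising sequence of \<open>J\<close>
  Cauchy, completeness yields a minimiser \<open>w\<close>, and a failure of the representation at
  some \<open>z\<close> would allow a further decrease of \<open>J\<close> along
  \<open>z\<close>.\<close>

lemma riesz_representation:
  fixes \<phi> :: "'x::{real_inner,banach} \<Rightarrow> real"
  assumes "bounded_linear \<phi>"
  obtains w where "\<And>x. \<phi> x = x \<bullet> w"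
proof -
  interpret \<phi>: bounded_linear \<phi> by fact
  obtain C where C: "\<And>x. norm (\<phi> x) \<le> norm x * C"
    using \<phi>.bounded by blast
  \<comment> \<open>The representing vector is the minimiser of this functional.\<close>
  define J where "J x = x \<bullet> x - 2 * \<phi> x" for x
  have "- C\<^sup>2 \<le> J x" for x
  proof -
    have "0 \<le> (norm x - C)\<^sup>2" by simp
    with C[of x] show ?thesis
      by (auto simp: J_def power2_norm_eq_inner[symmetric] power2_eq_square algebra_simps)
  qed
  then have bdd: "bdd_below (range J)" by (auto intro!: bdd_belowI)
  define d where "d = Inf (range J)"
  have d_le: "d \<le> J x" for x
    unfolding d_def by (intro cInf_lower bdd) auto
  have "\<exists>x. J x < d + 1 / Suc k" for k
    using cInf_lessD[of "range J" "d + 1 / Suc k"] by (auto simp: d_def)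
  then obtain X where X: "\<And>k. J (X k) < d + 1 / Suc k" by metis
  have par: "(norm (x - z))\<^sup>2 \<le> 2 * (J x - d) + 2 * (J z - d)" for x z
  proof -
    have "(norm (x - z))\<^sup>2 = 2 * J x + 2 * J z - 4 * J ((1/2) *\<^sub>R (x + z))"
      unfolding J_def \<phi>.scaleR \<phi>.add power2_norm_eq_inner
      by (simp add: inner_commute algebra_simps)
    with d_le[of "(1/2) *\<^sub>R (x + z)"] show ?thesis by simp
  qed
  have "Cauchy X"
  proof (rule metric_CauchyI)
    fix e :: real assume "0 < e"
    then obtain M where M: "4 / Suc M < e\<^sup>2"
      using reals_Archimedean[of "e\<^sup>2 / 4"] by (auto simp: field_simps)
    have "dist (X i) (X j) < e" if "M \<le> i" "M \<le> j" for i j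
    proof -
      have "1 / real (Suc i) \<le> 1 / real (Suc M)" "1 / real (Suc j) \<le> 1 / real (Suc M)"
        using that by (auto intro!: divide_left_mono)
      then have "(norm (X i - X j))\<^sup>2 < e\<^sup>2"
        using par[of "X i" "X j"] X[of i] X[of j] M by simp
      then show ?thesis
        using \<open>0 < e\<close> by (simp add: dist_norm power_less_imp_less_base)
    qed
    then show "\<exists>M. \<forall>i\<ge>M. \<forall>j\<ge>M. dist (X i) (X j) < e" by blast
  qed
  then obtain w where w: "X \<longlonglongrightarrow> w"
    using convergent_eq_Cauchy by blast
  have lim1: "(\<lambda>k. J (X k)) \<longlonglongrightarrow> J w"
    unfolding J_def by (intro tendsto_intros w \<phi>.tendsto)
  have lim2: "(\<lambda>k. d + 1 / Suc k) \<longlonglongrightarrow> d + 0"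
    by (intro tendsto_intros LIMSEQ_Suc[OF lim_1_over_n])
  have Jw: "J w \<le> d"
    using LIMSEQ_le[OF lim1 lim2] X less_imp_le by auto
  have "\<phi> z = z \<bullet> w" for z
  proof (rule ccontr)
    assume ne: "\<phi> z \<noteq> z \<bullet> w"
    define c where "c = \<phi> z - z \<bullet> w"
    have "z \<noteq> 0" using ne by (auto simp: \<phi>.zero)
    then have zz: "z \<bullet> z > 0" by simp
    \<comment> \<open>\<open>c / (z \<bullet> z)\<close> is the step length that minimises
      \<open>J\<close> on the line through \<open>w\<close> in direction \<open>z\<close>.\<close>
    have "J (w + (c / (z \<bullet> z)) *\<^sub>R z) = J w - c\<^sup>2 / (z \<bullet> z)"
      unfolding J_def \<phi>.scaleR \<phi>.add using zz
      by (simp add: c_def inner_simps inner_commute field_simps power2_eq_square)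
    moreover have "c\<^sup>2 / (z \<bullet> z) > 0" using zz ne by (simp add: c_def)
    ultimately show False using d_le[of "w + (c / (z \<bullet> z)) *\<^sub>R z"] Jw by linarith
  qed
  then show thesis by (rule that)
qed

text \<open>\<open>hadjoint\<close> rests on a choice in \<open>adjoint\<close> and a coercion by
  \<open>Blinfun\<close>. Riesz representation supplies a map \<open>f\<close> with the adjoint
  property, testing with \<open>f y\<close> shows that it is bounded, and uniqueness identifies it
  with the chosen one.\<close>

lemma hadjoint:
  fixes T :: "'x::{real_inner,banach} \<Rightarrow>\<^sub>L 'y::{real_inner,banach}"
  shows "T x \<bullet> y = x \<bullet> hadjoint T y"
proof -
  have "\<exists>w. \<forall>x. T x \<bullet> y = x \<bullet> w" for y
    by (rule riesz_representation[of "\<lambda>x. T x \<bullet> y"])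
       (auto intro!: bounded_linear_intros)
  then obtain f where f: "\<And>x y. T x \<bullet> y = x \<bullet> f y" by metis
  have eqI: "u = w" if "\<And>x. x \<bullet> u = x \<bullet> w" for u w :: 'x
    using that[of "u - w"] by (metis inner_diff_right inner_eq_zero_iff right_minus_eq)
  have "bounded_linear f"
  proof (rule bounded_linear_intro)
    show "f (y + z) = f y + f z" for y z
      by (rule eqI) (simp add: inner_add_right f[symmetric])
    show "f (c *\<^sub>R y) = c *\<^sub>R f y" for c y
      by (rule eqI) (simp add: f[symmetric])
    show "norm (f y) \<le> norm y * norm T" for y
    proof -
      have "norm (f y) * norm (f y) = T (f y) \<bullet> y"
        by (simp add: f power2_norm_eq_inner[symmetric] power2_eq_square)
      also have "\<dots> \<le> norm (T (f y)) * norm y" by (rule norm_cauchy_schwarz)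
      also have "\<dots> \<le> (norm T * norm (f y)) * norm y"
        by (intro mult_right_mono norm_blinfun) simp
      finally have "norm (f y) * norm (f y) \<le> norm (f y) * (norm y * norm T)"
        by (simp add: mult_ac)
      then show ?thesis
        by (cases "f y = 0") (auto dest: mult_left_le_imp_le)
    qed
  qed
  moreover have "adjoint (blinfun_apply T) = f"
    by (rule adjoint_unique) (simp add: f)
  ultimately show ?thesis
    by (simp add: hadjoint_def bounded_linear_Blinfun_apply f)
qed

section \<open>Spectrum of a self-adjoint operator\<close>

lemma selfadjointD: "selfadjoint_bounded S \<Longrightarrow> S x \<bullet> y = x \<bullet> S y"
  by (simp add: selfadjoint_bounded_def)

text \<open>For self-adjoint operators this turns out to be equivalent to invertibility, so that
  spectral points can be treated as approximate eigenvalues.\<close>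

definition bounded_below :: "('x::real_normed_vector \<Rightarrow>\<^sub>L 'x) \<Rightarrow> bool"
  where "bounded_below L \<longleftrightarrow> (\<exists>c>0. \<forall>x. c * norm x \<le> norm (L x))"

lemma bounded_below_compose:
  assumes "bounded_below L" "bounded_below M"
  shows "bounded_below (L o\<^sub>L M)"
proof -
  obtain c d where c: "c > 0" "\<And>x. c * norm x \<le> norm (L x)"
    and d: "d > 0" "\<And>x. d * norm x \<le> norm (M x)"
    using assms unfolding bounded_below_def by blast
  have "(c * d) * norm x \<le> norm (L (M x))" for x
    using order_trans[OF mult_left_mono[OF d(2)[of x], of c] c(2)[of "M x"]] c(1)
    by (simp add: mult.assoc)
  with c(1) d(1) show ?thesis
    unfolding bounded_below_def by (intro exI[of _ "c * d"]) auto
qed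

lemma bounded_below_of_form:
  fixes L :: "'x::real_inner \<Rightarrow>\<^sub>L 'x"
  assumes "c > 0" "\<And>x. c * (norm x)\<^sup>2 \<le> \<bar>L x \<bullet> x\<bar>"
  shows "bounded_below L"
proof -
  have "c * norm x \<le> norm (L x)" for x
  proof (cases "x = 0")
    case False
    have "(c * norm x) * norm x \<le> norm (L x) * norm x"
      using assms(2)[of x] Cauchy_Schwarz_ineq2[of "L x" x]
      by (simp add: power2_eq_square mult.assoc)
    then show ?thesis using False by simp
  qed simp
  then show ?thesis unfolding bounded_below_def using assms(1) by blast
qed

text \<open>With \<open>\<omega> = 1 / \<parallel>L\<parallel>\<^sup>2\<close> the equation \<open>L\<^sup>2 x = f\<close> is solved by the Landweber iteration
  \<open>x \<mapsto> x - \<omega> (L\<^sup>2 x - f)\<close>, which is a contraction.\<close>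

lemma selfadjoint_bounded_below_surj:
  fixes L :: "'x::{real_inner,banach} \<Rightarrow>\<^sub>L 'x"
  assumes sa: "selfadjoint_bounded L" and "bounded_below L"
  shows "surj (blinfun_apply L)"
proof (cases "L = 0")
  case True
  then have "x = 0" for x :: 'x
    using assms(2) by (auto simp: bounded_below_def mult_le_0_iff)
  then show ?thesis by (metis surjI)
next
  case False
  obtain c where c: "c > 0" "\<And>x. c * norm x \<le> norm (L x)"
    using assms(2) unfolding bounded_below_def by blast
  define \<omega> where "\<omega> = inverse ((norm L)\<^sup>2)"
  have \<omega>: "\<omega> > 0" using False by (simp add: \<omega>_def)
  \<comment> \<open>\<open>max 0\<close> spares a proof of \<open>c \<le> norm L\<close>;
    \<open>q\<^sup>2\<close> still dominates \<open>1 - \<omega> * c\<^sup>2\<close>.\<close>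
  define q where "q = sqrt (max 0 (1 - \<omega> * c\<^sup>2))"
  have q: "0 \<le> q" "q < 1" using \<omega> c(1) by (auto simp: q_def)
  have contr: "norm (x - \<omega> *\<^sub>R L (L x)) \<le> q * norm x" for x
  proof -
    have "\<omega> * (norm (L (L x)))\<^sup>2 \<le> \<omega> * (norm L * norm (L x))\<^sup>2"
      using \<omega> by (intro mult_left_mono power_mono norm_blinfun) auto
    also have "\<dots> = (norm (L x))\<^sup>2"
      using False by (simp add: \<omega>_def power_mult_distrib)
    finally have 1: "\<omega> * (norm (L (L x)))\<^sup>2 \<le> (norm (L x))\<^sup>2" .
    have "(norm (x - \<omega> *\<^sub>R L (L x)))\<^sup>2
        = (norm x)\<^sup>2 - 2 * \<omega> * (x \<bullet> L (L x)) + \<omega> * (\<omega> * (norm (L (L x)))\<^sup>2)"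
      by (simp add: power2_norm_eq_inner inner_diff_left inner_diff_right inner_commute[of "L (L x)" x]
          right_diff_distrib)
    also have "x \<bullet> L (L x) = (norm (L x))\<^sup>2"
      by (simp add: power2_norm_eq_inner selfadjointD[OF sa])
    also have "(norm x)\<^sup>2 - 2 * \<omega> * (norm (L x))\<^sup>2 + \<omega> * (\<omega> * (norm (L (L x)))\<^sup>2)
        \<le> (norm x)\<^sup>2 - \<omega> * (norm (L x))\<^sup>2"
      using mult_left_mono[OF 1, of \<omega>] \<omega> by simp
    also have "\<dots> \<le> (norm x)\<^sup>2 - \<omega> * (c * norm x)\<^sup>2"
      using \<omega> c by (intro diff_mono mult_left_mono power_mono) auto
    also have "\<dots> = (1 - \<omega> * c\<^sup>2) * (norm x)\<^sup>2"
      by (simp add: power_mult_distrib algebra_simps)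
    also have "\<dots> \<le> q\<^sup>2 * (norm x)\<^sup>2"
      by (intro mult_right_mono) (auto simp: q_def)
    finally have "(norm (x - \<omega> *\<^sub>R L (L x)))\<^sup>2 \<le> (q * norm x)\<^sup>2"
      by (simp add: power_mult_distrib)
    then show ?thesis
      by (rule power2_le_imp_le) (use q in auto)
  qed
  show ?thesis unfolding surj_def
  proof
    fix f
    have "\<exists>!x. x - \<omega> *\<^sub>R (L (L x) - f) = x"
    proof (rule banach_fix_type[OF q], intro allI)
      fix x z
      have "(x - \<omega> *\<^sub>R (L (L x) - f)) - (z - \<omega> *\<^sub>R (L (L z) - f)) = (x - z) - \<omega> *\<^sub>R L (L (x - z))"
        by (simp add: blinfun.diff_right algebra_simps)
      with contr[of "x - z"]
      show "dist (x - \<omega> *\<^sub>R (L (L x) - f)) (z - \<omega> *\<^sub>R (L (L z) - f)) \<le> q * dist x z"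
        by (simp only: dist_norm)
    qed
    then obtain x where "x - \<omega> *\<^sub>R (L (L x) - f) = x" by blast
    then have "\<omega> *\<^sub>R (L (L x) - f) = 0" by (metis add_diff_cancel_left' diff_add_cancel diff_self)
    then have "f = L (L x)" using \<omega> by simp
    then show "\<exists>u. f = L u" by blast
  qed
qed

text \<open>A lower bound \<open>c\<close> gives injectivity directly and surjectivity by the
  Landweber argument, and it bounds the inverse by \<open>1 / c\<close>.\<close>

lemma selfadjoint_invertible_iff:
  fixes L :: "'x::{real_inner,banach} \<Rightarrow>\<^sub>L 'x"
  assumes sa: "selfadjoint_bounded L"
  shows "(\<exists>R. R o\<^sub>L L = id_blinfun \<and> L o\<^sub>L R = id_blinfun) \<longleftrightarrow> bounded_below L"
proof
  assume "\<exists>R. R o\<^sub>L L = id_blinfun \<and> L o\<^sub>L R = id_blinfun"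
  then obtain R :: "'x \<Rightarrow>\<^sub>L 'x" where R: "\<And>x. R (L x) = x"
    by (metis blinfun_apply_blinfun_compose blinfun_apply_id_blinfun)
  \<comment> \<open>On the trivial space \<open>norm R = 0\<close>; the added \<open>1\<close> keeps
    the constant positive.\<close>
  have "inverse (norm R + 1) * norm x \<le> norm (L x)" for x
  proof -
    have "norm x \<le> norm R * norm (L x)" using norm_blinfun[of R "L x"] by (simp add: R)
    also have "\<dots> \<le> (norm R + 1) * norm (L x)" by (intro mult_right_mono) auto
    finally have "inverse (norm R + 1) * norm x
        \<le> inverse (norm R + 1) * ((norm R + 1) * norm (L x))"
      by (intro mult_left_mono) (auto simp: add_nonneg_nonneg)
    also have "\<dots> = norm (L x)"
      using add_nonneg_pos[OF norm_ge_zero[of R] zero_less_one]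
      by (simp only: mult.assoc[symmetric]) simp
    finally show ?thesis .
  qed
  moreover have "inverse (norm R + 1) > 0" by (simp add: add_nonneg_pos)
  ultimately show "bounded_below L" unfolding bounded_below_def by blast
next
  assume bb: "bounded_below L"
  then obtain c where c: "c > 0" "\<And>x. c * norm x \<le> norm (L x)"
    unfolding bounded_below_def by blast
  have inj: "inj (blinfun_apply L)"
  proof (rule injI)
    fix x z assume "L x = L z"
    then have "c * norm (x - z) \<le> 0"
      using c(2)[of "x - z"] by (simp add: blinfun.diff_right)
    then show "x = z" using c(1) by (simp add: mult_le_0_iff)
  qed
  define f where "f = inv (blinfun_apply L)"
  have Lf: "L (f x) = x" for x
    unfolding f_def by (rule surj_f_inv_f[OF selfadjoint_bounded_below_surj[OF sa bb]])
  have fL: "f (L x) = x" for x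
    unfolding f_def by (rule inv_f_f[OF inj])
  have "bounded_linear f"
  proof (rule bounded_linear_intro)
    show "f (x + z) = f x + f z" for x z
      by (rule injD[OF inj]) (simp add: Lf blinfun.add_right)
    show "f (r *\<^sub>R x) = r *\<^sub>R f x" for r x
      by (rule injD[OF inj]) (simp add: Lf blinfun.scaleR_right)
    show "norm (f x) \<le> norm x * (1 / c)" for x
      using c(2)[of "f x"] c(1) by (simp add: Lf field_simps)
  qed
  then have "Blinfun f o\<^sub>L L = id_blinfun \<and> L o\<^sub>L Blinfun f = id_blinfun"
    by (auto intro!: blinfun_eqI simp: bounded_linear_Blinfun_apply Lf fL)
  then show "\<exists>R. R o\<^sub>L L = id_blinfun \<and> L o\<^sub>L R = id_blinfun" by blast
qed

lemma selfadjoint_shift: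
  "selfadjoint_bounded S \<Longrightarrow> selfadjoint_bounded (S - l *\<^sub>R id_blinfun)"
  by (simp add: selfadjoint_bounded_def blinfun.diff_left blinfun.scaleR_left
      inner_diff_left inner_diff_right)

lemma spectrum_iff:
  "selfadjoint_bounded S \<Longrightarrow> l \<in> op_spectrum S \<longleftrightarrow> \<not> bounded_below (S - l *\<^sub>R id_blinfun)"
  by (simp add: op_spectrum_def selfadjoint_invertible_iff[OF selfadjoint_shift])

lemma spectrum_le_norm:
  assumes sa: "selfadjoint_bounded S" and l: "l \<in> op_spectrum S"
  shows "\<bar>l\<bar> \<le> norm S"
proof (rule ccontr)
  assume "\<not> \<bar>l\<bar> \<le> norm S"
  moreover have "(\<bar>l\<bar> - norm S) * norm x \<le> norm ((S - l *\<^sub>R id_blinfun) x)" for x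
    using norm_blinfun[of S x] norm_triangle_ineq2[of "l *\<^sub>R x" "S x"]
    by (simp add: blinfun.diff_left blinfun.scaleR_left norm_minus_commute algebra_simps)
  ultimately have "bounded_below (S - l *\<^sub>R id_blinfun)"
    unfolding bounded_below_def by (intro exI[of _ "\<bar>l\<bar> - norm S"]) auto
  with l spectrum_iff[OF sa] show False by blast
qed

lemma spectrum_nonneg:
  assumes sa: "selfadjoint_bounded S" and pos: "\<And>x. 0 \<le> S x \<bullet> x" and l: "l \<in> op_spectrum S"
  shows "0 \<le> l"
proof (rule ccontr)
  assume "\<not> 0 \<le> l"
  moreover have "- l * (norm x)\<^sup>2 \<le> \<bar>(S - l *\<^sub>R id_blinfun) x \<bullet> x\<bar>" for x
    using pos[of x]
    by (simp add: blinfun.diff_left blinfun.scaleR_left inner_diff_left power2_norm_eq_inner)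
  ultimately have "bounded_below (S - l *\<^sub>R id_blinfun)"
    by (intro bounded_below_of_form[of "- l"]) auto
  with l spectrum_iff[OF sa] show False by blast
qed

text \<open>A lower bound \<open>c\<close> at \<open>l\<close> leaves the lower bound
  \<open>c - dist k l\<close> at a nearby \<open>k\<close>, so the complement of the spectrum is
  open.\<close>

lemma compact_spectrum:
  assumes sa: "selfadjoint_bounded S"
  shows "compact (op_spectrum S)"
proof -
  have "open (- op_spectrum S)" unfolding open_dist
  proof (intro ballI)
    fix l assume "l \<in> - op_spectrum S"
    then obtain c where c: "c > 0" "\<And>x. c * norm x \<le> norm ((S - l *\<^sub>R id_blinfun) x)"
      using spectrum_iff[OF sa] by (auto simp: bounded_below_def)
    have "k \<in> - op_spectrum S" if "dist k l < c" for k
    proof -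
      have "(c - dist k l) * norm x \<le> norm ((S - k *\<^sub>R id_blinfun) x)" for x
      proof -
        have "(S - l *\<^sub>R id_blinfun) x - (k - l) *\<^sub>R x = (S - k *\<^sub>R id_blinfun) x"
          by (simp add: blinfun.diff_left blinfun.scaleR_left algebra_simps)
        then have "norm ((S - l *\<^sub>R id_blinfun) x) - \<bar>k - l\<bar> * norm x
            \<le> norm ((S - k *\<^sub>R id_blinfun) x)"
          by (metis norm_scaleR norm_triangle_ineq2)
        with c(2)[of x] show ?thesis by (simp add: dist_real_def algebra_simps)
      qed
      with that have "bounded_below (S - k *\<^sub>R id_blinfun)"
        unfolding bounded_below_def by (intro exI[of _ "c - dist k l"]) auto
      then show ?thesis using spectrum_iff[OF sa] by blast
    qed
    with c(1) show "\<exists>e>0. \<forall>k. dist k l < e \<longrightarrow> k \<in> - op_spectrum S" by blast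
  qed
  moreover have "bounded (op_spectrum S)"
    using spectrum_le_norm[OF sa] by (auto simp: bounded_iff)
  ultimately show ?thesis by (simp add: compact_eq_bounded_closed closed_def)
qed

section \<open>Polynomials of an operator\<close>

lemma poly_op_altdef:
  assumes "degree P \<le> n"
  shows "poly_op P S = (\<Sum>i\<le>n. coeff P i *\<^sub>R (((o\<^sub>L) S ^^ i) id_blinfun))"
  unfolding poly_op_def using assms
  by (intro sum.mono_neutral_left) (auto simp: coeff_eq_0)

lemma poly_op_0 [simp]: "poly_op 0 S = 0"
  by (simp add: poly_op_def)

text \<open>Horner form, the rule on which the inductions over polynomials run.\<close>

lemma poly_op_pCons [simp]: "poly_op (pCons c P) S = c *\<^sub>R id_blinfun + (S o\<^sub>L poly_op P S)"
proof -
  interpret r: bounded_linear "(o\<^sub>L) S"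
    by (rule bounded_bilinear.bounded_linear_right[OF bounded_bilinear_blinfun_compose])
  have "poly_op (pCons c P) S
      = (\<Sum>i\<le>Suc (degree P). coeff (pCons c P) i *\<^sub>R (((o\<^sub>L) S ^^ i) id_blinfun))"
    by (rule poly_op_altdef) (simp add: degree_pCons_le)
  also have "\<dots> = c *\<^sub>R id_blinfun + (S o\<^sub>L poly_op P S)"
    by (simp add: sum.atMost_Suc_shift poly_op_def r.sum r.scaleR del: sum.atMost_Suc)
  finally show ?thesis .
qed

lemma poly_op_add: "poly_op (P + Q) S = poly_op P S + poly_op Q S"
proof -
  let ?n = "max (degree P) (degree Q)"
  have "poly_op (P + Q) S = (\<Sum>i\<le>?n. coeff (P + Q) i *\<^sub>R (((o\<^sub>L) S ^^ i) id_blinfun))"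
    by (rule poly_op_altdef) (rule degree_add_le_max)
  then show ?thesis
    by (simp add: poly_op_altdef[of P ?n] poly_op_altdef[of Q ?n] scaleR_add_left sum.distrib)
qed

lemma poly_op_smult: "poly_op (smult c P) S = c *\<^sub>R poly_op P S"
  by (induction P)
     (auto simp: scaleR_add_right blinfun.bilinear_simps intro!: blinfun_eqI)

lemma poly_op_diff: "poly_op (P - Q) S = poly_op P S - poly_op Q S"
  using poly_op_add[of P "- Q" S] poly_op_smult[of "- 1" Q S] by simp

lemma poly_op_mult: "poly_op (P * Q) S = poly_op P S o\<^sub>L poly_op Q S"
  by (induction P)
     (auto simp: poly_op_add poly_op_smult blinfun.bilinear_simps intro!: blinfun_eqI)

lemma poly_op_commute: "poly_op P S (S x) = S (poly_op P S x)"
proof -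
  have "poly_op (P * [:0, 1:]) S = poly_op ([:0, 1:] * P) S" by (simp only: mult.commute)
  then have "blinfun_apply (poly_op (P * [:0, 1:]) S) x = poly_op ([:0, 1:] * P) S x" by simp
  then show ?thesis unfolding poly_op_mult by (simp add: blinfun.bilinear_simps)
qed

lemma selfadjoint_poly_op:
  assumes "selfadjoint_bounded S"
  shows "selfadjoint_bounded (poly_op P S)"
  using assms
  by (induction P)
     (auto simp: selfadjoint_bounded_def blinfun.bilinear_simps inner_simps poly_op_commute)

text \<open>The quadratic is the minimal polynomial of \<open>z\<close> over the reals: the
  remainder of \<open>Q\<close> has degree at most one and vanishes at a non-real point, hence is
  zero.\<close>

lemma real_poly_quadratic_dvd:
  fixes Q :: "real poly"
  assumes z: "poly (map_poly of_real Q) z = (0::complex)" and im: "Im z \<noteq> 0"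
  shows "[:(Re z)\<^sup>2 + (Im z)\<^sup>2, - 2 * Re z, 1:] dvd Q"
proof -
  let ?d = "[:(Re z)\<^sup>2 + (Im z)\<^sup>2, - 2 * Re z, 1:]"
  let ?c = "map_poly complex_of_real"
  have add: "?c (P + R) = ?c P + ?c R" and mult: "?c (P * R) = ?c P * ?c R" for P R
    by (auto intro!: poly_eqI simp: coeff_map_poly coeff_mult)
  define r where "r = Q mod ?d"
  have "degree r < 2 \<or> r = 0"
    using degree_mod_less[of ?d Q] by (auto simp: r_def)
  then have deg: "degree r \<le> 1" by auto
  have r: "r = [:coeff r 0, coeff r 1:]"
    using deg by (intro poly_eqI) (auto simp: coeff_pCons coeff_eq_0 split: nat.splits)
  have "poly (?c ?d) z = 0"
    by (simp add: map_poly_pCons complex_eq_iff power2_eq_square algebra_simps)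
  moreover have "?c Q = ?c (Q div ?d) * ?c ?d + ?c r"
    unfolding mult[symmetric] add[symmetric] r_def div_mult_mod_eq ..
  ultimately have "poly (?c r) z = 0" using z by simp
  then have "complex_of_real (coeff r 0) + z * complex_of_real (coeff r 1) = 0"
    by (subst (asm) r) (simp add: map_poly_pCons)
  then have "coeff r 1 = 0" "coeff r 0 = 0" using im by (auto simp: complex_eq_iff)
  then have "r = 0" using r by simp
  then show ?thesis unfolding r_def by (simp add: mod_eq_0_iff_dvd)
qed

text \<open>Split off linear factors at real roots and, at a pair of complex roots, the quadratic
  \<open>(t - b)\<^sup>2 + c\<^sup>2\<close>, whose value at a self-adjoint operator is at least \<open>c\<^sup>2\<close>.\<close>

lemma poly_op_bounded_below:
  fixes S :: "'x::{real_inner,banach} \<Rightarrow>\<^sub>L 'x"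
  assumes sa: "selfadjoint_bounded S"
    and "Q \<noteq> 0" "\<And>l. l \<in> op_spectrum S \<Longrightarrow> poly Q l \<noteq> 0"
  shows "bounded_below (poly_op Q S)"
  using assms(2,3)
proof (induction "degree Q" arbitrary: Q rule: less_induct)
  case less
  \<comment> \<open>After splitting off \<open>d\<close>, the cofactor has smaller degree and still
    no zero on the spectrum, and lower bounds compose.\<close>
  have step: "bounded_below (poly_op Q S)"
    if dvd: "d dvd Q" and deg: "degree d > 0" and d: "bounded_below (poly_op d S)" for d
  proof -
    obtain R where R: "Q = d * R" using dvd by (rule dvdE)
    with less.prems(1) have nz: "d \<noteq> 0" "R \<noteq> 0" by auto
    then have "degree R < degree Q" using deg by (simp add: R degree_mult_eq)
    then have "bounded_below (poly_op R S)"
      by (rule less.hyps) (use less.prems(2) nz in \<open>auto simp: R\<close>)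
    with d show ?thesis unfolding R poly_op_mult by (rule bounded_below_compose)
  qed
  show ?case
  proof (cases "degree Q = 0")
    case True
    then obtain c where c: "Q = [:c:]" by (rule degree_eq_zeroE)
    with less.prems(1) have "c \<noteq> 0" by simp
    then show ?thesis unfolding bounded_below_def
      by (intro exI[of _ "\<bar>c\<bar>"]) (auto simp: c blinfun.bilinear_simps)
  next
    case False
    then have "\<not> constant (poly (map_poly complex_of_real Q))"
      by (simp add: constant_degree degree_map_poly)
    then obtain z where z: "poly (map_poly complex_of_real Q) z = 0"
      using fundamental_theorem_of_algebra by blast
    show ?thesis
    proof (cases "Im z = 0")
      case True
      have "poly (map_poly complex_of_real Q) z = complex_of_real (poly Q (Re z))"
        using complex_eq_iff[of z "complex_of_real (Re z)"] True
        by (simp add: poly_altdef degree_map_poly coeff_map_poly)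
      with z have root: "poly Q (Re z) = 0" by simp
      with less.prems(2) have "Re z \<notin> op_spectrum S" by blast
      then have "bounded_below (poly_op [:- Re z, 1:] S)"
        using spectrum_iff[OF sa, of "Re z"]
        by (auto simp: bounded_below_def blinfun.bilinear_simps)
      with root show ?thesis by (intro step[of "[:- Re z, 1:]"]) (auto simp: poly_eq_0_iff_dvd)
    next
      case False
      have "bounded_below (poly_op [:(Re z)\<^sup>2 + (Im z)\<^sup>2, - 2 * Re z, 1:] S)" (is "bounded_below ?q")
      proof (rule bounded_below_of_form)
        show "(Im z)\<^sup>2 > 0" using False by simp
        show "(Im z)\<^sup>2 * (norm x)\<^sup>2 \<le> \<bar>?q x \<bullet> x\<bar>" for x
        proof -
          have "?q x \<bullet> x = S (S x) \<bullet> x - 2 * Re z * (S x \<bullet> x) + ((Re z)\<^sup>2 + (Im z)\<^sup>2) * (x \<bullet> x)"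
            by (simp add: blinfun.bilinear_simps inner_simps algebra_simps)
          also have "\<dots> = (norm (S x - Re z *\<^sub>R x))\<^sup>2 + (Im z)\<^sup>2 * (norm x)\<^sup>2"
            unfolding power2_norm_eq_inner
            by (simp add: selfadjointD[OF sa, of "S x" x] inner_diff_left inner_diff_right
                inner_commute[of x "S x"] power2_eq_square algebra_simps)
          finally show ?thesis by simp
        qed
      qed
      then show ?thesis using real_poly_quadratic_dvd[OF z False]
        by (intro step[of "[:(Re z)\<^sup>2 + (Im z)\<^sup>2, - 2 * Re z, 1:]"]) auto
    qed
  qed
qed

text \<open>Along vectors \<open>x\<close> with \<open>\<parallel>L x\<parallel> \<longrightarrow> \<parallel>L\<parallel> \<parallel>x\<parallel>\<close> also \<open>(\<parallel>L\<parallel>\<^sup>2 - L\<^sup>2) x \<longrightarrow> 0\<close>.\<close>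

lemma selfadjoint_norm_not_bounded_below:
  fixes L :: "'x::{real_inner,banach} \<Rightarrow>\<^sub>L 'x"
  assumes sa: "selfadjoint_bounded L" and nz: "(x\<^sub>0::'x) \<noteq> 0"
  shows "\<not> bounded_below ((norm L)\<^sup>2 *\<^sub>R id_blinfun - (L o\<^sub>L L))"
proof
  let ?N = "norm L"
  assume "bounded_below (?N\<^sup>2 *\<^sub>R id_blinfun - (L o\<^sub>L L))"
  then obtain c where c: "c > 0" "\<And>x. c * norm x \<le> norm (?N\<^sup>2 *\<^sub>R x - L (L x))"
    by (auto simp: bounded_below_def blinfun.bilinear_simps)
  have "L \<noteq> 0" using c(1) c(2)[of x\<^sub>0] nz by (auto simp: mult_le_0_iff)
  then have N: "?N > 0" by simp
  have est: "c\<^sup>2 * (norm x)\<^sup>2 \<le> ?N\<^sup>2 * (?N\<^sup>2 * (norm x)\<^sup>2 - (norm (L x))\<^sup>2)" for x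
  proof -
    have "(norm (L (L x)))\<^sup>2 \<le> (?N * norm (L x))\<^sup>2"
      by (intro power_mono norm_blinfun) auto
    then have 1: "(norm (L (L x)))\<^sup>2 \<le> ?N\<^sup>2 * (norm (L x))\<^sup>2" by (simp add: power_mult_distrib)
    have "c\<^sup>2 * (norm x)\<^sup>2 \<le> (norm (?N\<^sup>2 *\<^sub>R x - L (L x)))\<^sup>2"
      using power_mono[OF c(2)[of x], of 2] c(1) by (simp add: power_mult_distrib)
    also have "\<dots> = ?N\<^sup>2 * ?N\<^sup>2 * (norm x)\<^sup>2 - 2 * ?N\<^sup>2 * (x \<bullet> L (L x)) + (norm (L (L x)))\<^sup>2"
      by (simp add: power2_norm_eq_inner[of "_ - _"] inner_diff_left inner_diff_right
          inner_commute[of "L (L x)" x] power2_norm_eq_inner[of x] power2_norm_eq_inner[of "L (L x)"])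
        (simp add: right_diff_distrib power4_eq_xxxx power2_eq_square)
    also have "x \<bullet> L (L x) = (norm (L x))\<^sup>2"
      by (simp add: power2_norm_eq_inner selfadjointD[OF sa])
    finally show ?thesis using 1 by (simp add: algebra_simps)
  qed
  have lt: "(norm (L x))\<^sup>2 \<le> (?N\<^sup>2 - c\<^sup>2 / ?N\<^sup>2) * (norm x)\<^sup>2" for x
    using est[of x] N by (simp add: field_simps)
  \<comment> \<open>\<open>b\<close> would be an operator bound for \<open>L\<close> strictly below
    \<open>norm L\<close>.\<close>
  define b where "b = sqrt (max 0 (?N\<^sup>2 - c\<^sup>2 / ?N\<^sup>2))"
  have "norm (L x) \<le> b * norm x" for x
  proof (rule power2_le_imp_le)
    have "(?N\<^sup>2 - c\<^sup>2 / ?N\<^sup>2) * (norm x)\<^sup>2 \<le> b\<^sup>2 * (norm x)\<^sup>2"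
      by (intro mult_right_mono) (auto simp: b_def)
    with lt[of x] show "(norm (L x))\<^sup>2 \<le> (b * norm x)\<^sup>2" by (simp add: power_mult_distrib)
  qed (simp add: b_def)
  then have "?N \<le> b" by (intro norm_blinfun_bound) (auto simp: b_def)
  moreover have "b < ?N"
    unfolding b_def using N c(1) by (intro real_less_lsqrt) auto
  ultimately show False by simp
qed

text \<open>On an empty spectrum the polynomial \<open>(norm S)\<^sup>2 - t\<^sup>2\<close> has no
  zero, so its value at \<open>S\<close> would be bounded below, contrary to the preceding lemma.
  The vector \<open>x\<^sub>0\<close> excludes the trivial space, where every spectrum is
  empty.\<close>

lemma spectrum_nonempty:
  fixes S :: "'x::{real_inner,banach} \<Rightarrow>\<^sub>L 'x"
  assumes sa: "selfadjoint_bounded S" and nz: "(x\<^sub>0::'x) \<noteq> 0"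
  shows "op_spectrum S \<noteq> {}"
proof
  assume "op_spectrum S = {}"
  then have "bounded_below (poly_op [:(norm S)\<^sup>2, 0, - 1:] S)"
    by (intro poly_op_bounded_below[OF sa]) auto
  moreover have "poly_op [:(norm S)\<^sup>2, 0, - 1:] S = (norm S)\<^sup>2 *\<^sub>R id_blinfun - (S o\<^sub>L S)"
    by (rule blinfun_eqI) (simp add: blinfun.bilinear_simps)
  ultimately show False
    using selfadjoint_norm_not_bounded_below[OF sa nz] by simp
qed

text \<open>With \<open>L = poly_op P S\<close>, the operator
  \<open>(norm L)\<^sup>2 - L\<^sup>2\<close> is not bounded below. Hence
  \<open>(norm L)\<^sup>2 - P\<^sup>2\<close> vanishes at a spectral point, where \<open>P\<close>
  attains the value \<open>norm L\<close> up to sign.\<close>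

lemma norm_poly_op_le:
  fixes S :: "'x::{real_inner,banach} \<Rightarrow>\<^sub>L 'x"
  assumes sa: "selfadjoint_bounded S" and "0 \<le> M"
    and M: "\<And>l. l \<in> op_spectrum S \<Longrightarrow> \<bar>poly P l\<bar> \<le> M"
  shows "norm (poly_op P S) \<le> M"
proof (cases "poly_op P S = 0")
  case False
  let ?L = "poly_op P S"
  let ?Q = "[:(norm ?L)\<^sup>2:] - P * P"
  have Q: "poly_op ?Q S = (norm ?L)\<^sup>2 *\<^sub>R id_blinfun - (?L o\<^sub>L ?L)"
    by (simp add: poly_op_diff poly_op_mult)
  from False obtain x where "?L x \<noteq> 0" by (metis blinfun_eqI blinfun.zero_left)
  then have nz: "x \<noteq> 0" by auto
  have "\<not> bounded_below (poly_op ?Q S)"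
    unfolding Q by (rule selfadjoint_norm_not_bounded_below[OF selfadjoint_poly_op[OF sa] nz])
  \<comment> \<open>\<open>poly_op_bounded_below\<close> says nothing about the zero polynomial; in
    that case any spectral point will do, and \<open>spectrum_nonempty\<close> supplies one.\<close>
  then consider "?Q = 0" | l where "l \<in> op_spectrum S" "poly ?Q l = 0"
    using poly_op_bounded_below[OF sa] by blast
  then obtain l where "(poly P l)\<^sup>2 = (norm ?L)\<^sup>2" "l \<in> op_spectrum S"
  proof cases
    case 1
    obtain l where "l \<in> op_spectrum S" using spectrum_nonempty[OF sa nz] by blast
    moreover from 1 have "poly ?Q l = 0" by simp
    ultimately show ?thesis using that by (simp add: power2_eq_square)
  next
    case 2
    with that show ?thesis by (simp add: power2_eq_square)
  qed
  then have "\<bar>poly P l\<bar> = \<bar>norm ?L\<bar>" by (simp only: power2_eq_iff abs_eq_iff)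
  with M[OF \<open>l \<in> op_spectrum S\<close>] show ?thesis by simp
qed (use assms in simp)

section \<open>Continuous functional calculus\<close>

lemma polynomial_approximation:
  fixes f :: "real \<Rightarrow> real"
  assumes "compact K" "continuous_on K f"
  obtains P where "uniform_limit K (\<lambda>k. poly (P k)) f sequentially"
proof -
  have "\<exists>P. \<forall>x\<in>K. \<bar>f x - poly P x\<bar> < 1 / Suc k" for k
  proof -
    obtain g where g: "real_polynomial_function g" "\<And>x. x \<in> K \<Longrightarrow> \<bar>f x - g x\<bar> < 1 / Suc k"
      using Stone_Weierstrass_real_polynomial_function[OF assms, of "1 / Suc k"] by auto
    obtain c n where "g = (\<lambda>x. \<Sum>i\<le>n. c i * x ^ i)"
      using g(1) real_polynomial_function_iff_sum by blast
    then have "g = poly (\<Sum>i\<le>n. monom (c i) i)" by (simp add: fun_eq_iff poly_sum poly_monom)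
    with g(2) show ?thesis by blast
  qed
  then obtain P where P: "\<And>k x. x \<in> K \<Longrightarrow> \<bar>f x - poly (P k) x\<bar> < 1 / Suc k" by metis
  have "uniform_limit K (\<lambda>k. poly (P k)) f sequentially"
  proof (rule uniform_limitI)
    fix e :: real assume "e > 0"
    have "\<forall>\<^sub>F k in sequentially. 1 / Suc k < e"
      using LIMSEQ_Suc[OF lim_1_over_n] \<open>e > 0\<close> by (rule order_tendstoD)
    then show "\<forall>\<^sub>F k in sequentially. \<forall>x\<in>K. dist (poly (P k) x) (f x) < e"
    proof eventually_elim
      case (elim k)
      with P show ?case by (metis dist_commute dist_real_def order.strict_trans)
    qed
  qed
  then show thesis by (rule that)
qed

lemma norm_poly_op_diff_le:
  assumes "selfadjoint_bounded S" "0 \<le> e"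
    and "\<And>l. l \<in> op_spectrum S \<Longrightarrow> \<bar>poly P l - poly Q l\<bar> \<le> e"
  shows "norm (poly_op P S - poly_op Q S) \<le> e"
  using norm_poly_op_le[OF assms(1,2), of "P - Q"] assms(3) by (simp add: poly_op_diff)

text \<open>This justifies the definite description in \<open>op_fun\<close>. The norm estimate on
  the spectrum makes \<open>poly_op (P k) S\<close> Cauchy and forces the same limit for every other
  approximating sequence; the given \<open>P\<close> rules out a vacuous description.\<close>

lemma op_fun_limit:
  fixes S :: "'x::{real_inner,banach} \<Rightarrow>\<^sub>L 'x"
  assumes sa: "selfadjoint_bounded S"
    and P: "uniform_limit (op_spectrum S) (\<lambda>k. poly (P k)) f sequentially"
  shows "(\<lambda>k. poly_op (P k) S) \<longlonglongrightarrow> op_fun f S"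
proof -
  have near: "\<forall>\<^sub>F k in sequentially. \<forall>l\<in>op_spectrum S. \<bar>poly (Q k) l - f l\<bar> < e / 2"
    if "uniform_limit (op_spectrum S) (\<lambda>k. poly (Q k)) f sequentially" "e > 0" for Q and e :: real
    using uniform_limitD[OF that(1), of "e / 2"] that(2) by (simp add: dist_real_def)
  have "Cauchy (\<lambda>k. poly_op (P k) S)"
  proof (rule CauchyI)
    fix e :: real assume e: "e > 0"
    then obtain N where N: "\<And>k l. k \<ge> N \<Longrightarrow> l \<in> op_spectrum S \<Longrightarrow> \<bar>poly (P k) l - f l\<bar> < e / 2 / 2"
      using near[OF P, of "e / 2"] by (auto simp: eventually_sequentially)
    have "norm (poly_op (P i) S - poly_op (P j) S) < e" if "i \<ge> N" "j \<ge> N" for i j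
    proof -
      have "norm (poly_op (P i) S - poly_op (P j) S) \<le> e / 2"
      proof (rule norm_poly_op_diff_le[OF sa])
        show "\<bar>poly (P i) l - poly (P j) l\<bar> \<le> e / 2" if "l \<in> op_spectrum S" for l
          using N[OF \<open>i \<ge> N\<close> that] N[OF \<open>j \<ge> N\<close> that] by linarith
      qed (use e in simp)
      then show ?thesis using e by simp
    qed
    then show "\<exists>N. \<forall>i\<ge>N. \<forall>j\<ge>N. norm (poly_op (P i) S - poly_op (P j) S) < e" by blast
  qed
  then obtain F where F: "(\<lambda>k. poly_op (P k) S) \<longlonglongrightarrow> F"
    using convergent_eq_Cauchy by blast
  have all: "(\<lambda>k. poly_op (Q k) S) \<longlonglongrightarrow> F"
    if Q: "uniform_limit (op_spectrum S) (\<lambda>k. poly (Q k)) f sequentially" for Q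
  proof (rule Lim_transform[OF F])
    show "(\<lambda>k. poly_op (Q k) S - poly_op (P k) S) \<longlonglongrightarrow> 0"
    proof (rule tendstoI)
      fix e :: real assume e: "e > 0"
      have "\<forall>\<^sub>F k in sequentially. norm (poly_op (Q k) S - poly_op (P k) S) \<le> e / 2"
        using near[OF P half_gt_zero[OF e]] near[OF Q half_gt_zero[OF e]]
      proof (eventually_elim, intro norm_poly_op_diff_le[OF sa])
        fix k l
        assume "\<forall>l\<in>op_spectrum S. \<bar>poly (P k) l - f l\<bar> < e / 2 / 2"
          "\<forall>l\<in>op_spectrum S. \<bar>poly (Q k) l - f l\<bar> < e / 2 / 2" "l \<in> op_spectrum S"
        then have "\<bar>poly (P k) l - f l\<bar> < e / 2 / 2" "\<bar>poly (Q k) l - f l\<bar> < e / 2 / 2" by auto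
        then show "\<bar>poly (Q k) l - poly (P k) l\<bar> \<le> e / 2" by linarith
      qed (use e in auto)
      then show "\<forall>\<^sub>F k in sequentially. dist (poly_op (Q k) S - poly_op (P k) S) 0 < e"
        by eventually_elim (use e in simp)
    qed
  qed
  have "op_fun f S = F"
    unfolding op_fun_def
  proof (rule the_equality)
    show "\<forall>Q. uniform_limit (op_spectrum S) (\<lambda>k. poly (Q k)) f sequentially
        \<longrightarrow> (\<lambda>k. poly_op (Q k) S) \<longlonglongrightarrow> F"
      using all by blast
  next
    fix F'
    assume "\<forall>Q. uniform_limit (op_spectrum S) (\<lambda>k. poly (Q k)) f sequentially
        \<longrightarrow> (\<lambda>k. poly_op (Q k) S) \<longlonglongrightarrow> F'"
    with P F show "F' = F" by (blast intro: LIMSEQ_unique)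
  qed
  with F show ?thesis by simp
qed

lemma op_fun_approximation:
  fixes S :: "'x::{real_inner,banach} \<Rightarrow>\<^sub>L 'x"
  assumes "selfadjoint_bounded S" "continuous_on (op_spectrum S) f"
  obtains P where "uniform_limit (op_spectrum S) (\<lambda>k. poly (P k)) f sequentially"
    "(\<lambda>k. poly_op (P k) S) \<longlonglongrightarrow> op_fun f S"
  using polynomial_approximation[OF compact_spectrum assms(2)] op_fun_limit assms(1) by metis

lemma op_fun_poly:
  assumes "selfadjoint_bounded S"
  shows "op_fun (poly P) S = poly_op P S"
  using op_fun_limit[OF assms, of "\<lambda>_. P" "poly P"]
  by (simp add: uniform_limit_const LIMSEQ_const_iff)

lemma op_fun_cong:
  assumes sa: "selfadjoint_bounded S" and f: "continuous_on (op_spectrum S) f"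
    and eq: "\<And>t. t \<in> op_spectrum S \<Longrightarrow> f t = g t"
  shows "op_fun f S = op_fun g S"
proof -
  obtain P where P: "uniform_limit (op_spectrum S) (\<lambda>k. poly (P k)) f sequentially"
    "(\<lambda>k. poly_op (P k) S) \<longlonglongrightarrow> op_fun f S"
    using op_fun_approximation[OF sa f] .
  have "uniform_limit (op_spectrum S) (\<lambda>k. poly (P k)) g sequentially"
    using P(1) eq by (simp cong: uniform_limit_cong')
  from op_fun_limit[OF sa this] P(2) show ?thesis by (rule LIMSEQ_unique[rotated])
qed

lemma op_fun_add:
  assumes sa: "selfadjoint_bounded S"
    and f: "continuous_on (op_spectrum S) f" and g: "continuous_on (op_spectrum S) g"
  shows "op_fun (\<lambda>t. f t + g t) S = op_fun f S + op_fun g S"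
proof -
  obtain P where P: "uniform_limit (op_spectrum S) (\<lambda>k. poly (P k)) f sequentially"
    "(\<lambda>k. poly_op (P k) S) \<longlonglongrightarrow> op_fun f S"
    using op_fun_approximation[OF sa f] .
  obtain Q where Q: "uniform_limit (op_spectrum S) (\<lambda>k. poly (Q k)) g sequentially"
    "(\<lambda>k. poly_op (Q k) S) \<longlonglongrightarrow> op_fun g S"
    using op_fun_approximation[OF sa g] .
  have "uniform_limit (op_spectrum S) (\<lambda>k. poly (P k + Q k)) (\<lambda>t. f t + g t) sequentially"
    using uniform_limit_add[OF P(1) Q(1)] by (simp flip: poly_add)
  from op_fun_limit[OF sa this] tendsto_add[OF P(2) Q(2)]
  show ?thesis by (simp add: poly_op_add LIMSEQ_unique)
qed

lemma op_fun_mult: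
  assumes sa: "selfadjoint_bounded S"
    and f: "continuous_on (op_spectrum S) f" and g: "continuous_on (op_spectrum S) g"
  shows "op_fun (\<lambda>t. f t * g t) S = op_fun f S o\<^sub>L op_fun g S"
proof -
  obtain P where P: "uniform_limit (op_spectrum S) (\<lambda>k. poly (P k)) f sequentially"
    "(\<lambda>k. poly_op (P k) S) \<longlonglongrightarrow> op_fun f S"
    using op_fun_approximation[OF sa f] .
  obtain Q where Q: "uniform_limit (op_spectrum S) (\<lambda>k. poly (Q k)) g sequentially"
    "(\<lambda>k. poly_op (Q k) S) \<longlonglongrightarrow> op_fun g S"
    using op_fun_approximation[OF sa g] .
  \<comment> \<open>Uniform convergence passes to products because the limits are bounded on the
    compact spectrum.\<close>
  have "bounded (f ` op_spectrum S)" "bounded (g ` op_spectrum S)"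
    using compact_continuous_image[OF f compact_spectrum[OF sa]]
      compact_continuous_image[OF g compact_spectrum[OF sa]] compact_imp_bounded by auto
  then have "uniform_limit (op_spectrum S) (\<lambda>k. poly (P k * Q k)) (\<lambda>t. f t * g t) sequentially"
    using uniform_lim_mult[OF P(1) Q(1)] by (simp flip: poly_mult)
  from op_fun_limit[OF sa this]
    bounded_bilinear.tendsto[OF bounded_bilinear_blinfun_compose P(2) Q(2)]
  show ?thesis by (simp add: poly_op_mult LIMSEQ_unique)
qed

lemma op_fun_const:
  assumes "selfadjoint_bounded S"
  shows "op_fun (\<lambda>t. c) S = c *\<^sub>R id_blinfun"
proof -
  have "(\<lambda>t. c) = poly [:c:]" by auto
  then show ?thesis using op_fun_poly[OF assms, of "[:c:]"] by simp
qed

lemma op_fun_ident: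
  assumes "selfadjoint_bounded S"
  shows "op_fun (\<lambda>t. t) S = S"
proof -
  have "(\<lambda>t. t) = poly [:0, 1 :: real:]" by auto
  then show ?thesis using op_fun_poly[OF assms, of "[:0, 1:]"] by (auto intro!: blinfun_eqI)
qed

lemma op_fun_cmult:
  assumes "selfadjoint_bounded S" "continuous_on (op_spectrum S) f"
  shows "op_fun (\<lambda>t. c * f t) S = c *\<^sub>R op_fun f S"
  using op_fun_mult[OF assms(1) continuous_on_const assms(2), of c] op_fun_const[OF assms(1)]
  by (auto intro!: blinfun_eqI simp: blinfun.bilinear_simps)

lemma selfadjoint_op_fun:
  assumes sa: "selfadjoint_bounded S" and f: "continuous_on (op_spectrum S) f"
  shows "selfadjoint_bounded (op_fun f S)"
  unfolding selfadjoint_bounded_def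
proof (intro allI)
  fix x y
  obtain P where P: "(\<lambda>k. poly_op (P k) S) \<longlonglongrightarrow> op_fun f S"
    using op_fun_approximation[OF sa f] by metis
  have "(\<lambda>k. poly_op (P k) S x \<bullet> y) \<longlonglongrightarrow> op_fun f S x \<bullet> y"
    "(\<lambda>k. poly_op (P k) S x \<bullet> y) \<longlonglongrightarrow> x \<bullet> op_fun f S y"
    unfolding selfadjointD[OF selfadjoint_poly_op[OF sa]]
    by (subst selfadjointD[OF selfadjoint_poly_op[OF sa], symmetric]) (intro tendsto_intros P)+
  then show "op_fun f S x \<bullet> y = x \<bullet> op_fun f S y" by (rule LIMSEQ_unique)
qed

lemma norm_op_fun_le:
  assumes sa: "selfadjoint_bounded S" and f: "continuous_on (op_spectrum S) f"
    and "0 \<le> M" and M: "\<And>t. t \<in> op_spectrum S \<Longrightarrow> \<bar>f t\<bar> \<le> M"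
  shows "norm (op_fun f S) \<le> M"
proof (rule field_le_epsilon)
  fix e :: real assume e: "e > 0"
  obtain P where P: "uniform_limit (op_spectrum S) (\<lambda>k. poly (P k)) f sequentially"
    "(\<lambda>k. poly_op (P k) S) \<longlonglongrightarrow> op_fun f S"
    using op_fun_approximation[OF sa f] .
  have "\<forall>\<^sub>F k in sequentially. norm (poly_op (P k) S) \<le> M + e"
    using uniform_limitD[OF P(1) e]
  proof (eventually_elim, intro norm_poly_op_le[OF sa])
    fix k l
    assume "\<forall>t\<in>op_spectrum S. dist (poly (P k) t) (f t) < e" and l: "l \<in> op_spectrum S"
    then have "\<bar>poly (P k) l - f l\<bar> < e" by (auto simp: dist_real_def)
    with M[OF l] show "\<bar>poly (P k) l\<bar> \<le> M + e" by linarith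
  qed (use e \<open>0 \<le> M\<close> in auto)
  then show "norm (op_fun f S) \<le> M + e"
    using tendsto_upperbound[OF tendsto_norm[OF P(2)]] by simp
qed

text \<open>Positivity is read off from a norm: if \<open>u = g - f\<close> takes values in
  \<open>[0, M]\<close> on the spectrum, then \<open>\<bar>M - u\<bar> \<le> M\<close>, so
  \<open>(M - u)(S)\<close> has norm at most \<open>M\<close> and the form of \<open>u(S)\<close> is
  nonnegative.\<close>

lemma op_fun_mono:
  fixes S :: "'x::{real_inner,banach} \<Rightarrow>\<^sub>L 'x"
  assumes sa: "selfadjoint_bounded S"
    and f: "continuous_on (op_spectrum S) f" and g: "continuous_on (op_spectrum S) g"
    and le: "\<And>t. t \<in> op_spectrum S \<Longrightarrow> f t \<le> g t"
  shows "op_fun f S x \<bullet> x \<le> op_fun g S x \<bullet> x"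
proof -
  have u: "continuous_on (op_spectrum S) (\<lambda>t. g t + (- 1) * f t)"
    by (intro continuous_intros f g)
  then have "bounded ((\<lambda>t. g t + (- 1) * f t) ` op_spectrum S)"
    by (intro compact_imp_bounded compact_continuous_image compact_spectrum[OF sa])
  then obtain M where "M > 0" and M: "\<And>t. t \<in> op_spectrum S \<Longrightarrow> \<bar>g t + (- 1) * f t\<bar> \<le> M"
    by (auto simp: bounded_pos)
  let ?R = "op_fun (\<lambda>t. M + (- 1) * (g t + (- 1) * f t)) S"
  have "norm ?R \<le> M"
  proof (rule norm_op_fun_le[OF sa])
    show "\<bar>M + (- 1) * (g t + (- 1) * f t)\<bar> \<le> M" if "t \<in> op_spectrum S" for t
      using M[OF that] le[OF that] by simp
  qed (use \<open>M > 0\<close> in \<open>auto intro!: continuous_intros f g\<close>)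
  then have "norm (?R x) \<le> M * norm x"
    using norm_blinfun[of ?R x] mult_right_mono[of "norm ?R" M "norm x"] by simp
  then have "?R x \<bullet> x \<le> M * norm x * norm x"
    using norm_cauchy_schwarz[of "?R x" x] mult_right_mono[of "norm (?R x)" "M * norm x" "norm x"]
    by simp
  moreover have "?R = M *\<^sub>R id_blinfun + (- 1) *\<^sub>R (op_fun g S + (- 1) *\<^sub>R op_fun f S)"
    by (subst op_fun_add[OF sa] op_fun_cmult[OF sa] op_fun_const[OF sa],
        (intro continuous_intros f g)+)+ (simp add: op_fun_const[OF sa])
  then have "?R x \<bullet> x = M * norm x * norm x - (op_fun g S x \<bullet> x - op_fun f S x \<bullet> x)"
    by (simp add: blinfun.bilinear_simps inner_diff_left inner_add_left
        power2_norm_eq_inner[symmetric] power2_eq_square mult.assoc)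
  ultimately show ?thesis by simp
qed

lemma norm_op_fun_power2:
  assumes sa: "selfadjoint_bounded S" and f: "continuous_on (op_spectrum S) f"
  shows "(norm (op_fun f S x))\<^sup>2 = op_fun (\<lambda>t. (f t)\<^sup>2) S x \<bullet> x"
  unfolding power2_norm_eq_inner
  by (simp add: power2_eq_square op_fun_mult[OF sa f f] selfadjointD[OF selfadjoint_op_fun[OF sa f]])

lemma norm_op_fun_power2_le:
  assumes sa: "selfadjoint_bounded S"
    and f: "continuous_on (op_spectrum S) f" and g: "continuous_on (op_spectrum S) g"
    and le: "\<And>t. t \<in> op_spectrum S \<Longrightarrow> (f t)\<^sup>2 \<le> g t"
  shows "(norm (op_fun f S x))\<^sup>2 \<le> op_fun g S x \<bullet> x"
  unfolding norm_op_fun_power2[OF sa f]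
  by (intro op_fun_mono[OF sa _ g le] continuous_intros f)

section \<open>Filter functions of the method\<close>

text \<open>The residual function of nonstationary iterated Tikhonov regularization;
  \<open>g_fun_residual\<close> links it to \<open>g_fun\<close>.\<close>

definition residual_fun :: "(nat \<Rightarrow> real) \<Rightarrow> nat \<Rightarrow> real \<Rightarrow> real"
  where "residual_fun \<alpha> n t = (\<Prod>k=1..n. \<alpha> k / (t + \<alpha> k))"

lemma residual_fun_0 [simp]: "residual_fun \<alpha> 0 t = 1"
  by (simp add: residual_fun_def)

lemma residual_fun_Suc:
  "residual_fun \<alpha> (Suc n) t = residual_fun \<alpha> n t * (\<alpha> (Suc n) / (t + \<alpha> (Suc n)))"
  by (simp add: residual_fun_def)

lemma sigma_sum_0 [simp]: "sigma_sum \<alpha> 0 = 0"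
  by (simp add: sigma_sum_def)

lemma sigma_sum_Suc: "sigma_sum \<alpha> (Suc n) = sigma_sum \<alpha> n + 1 / \<alpha> (Suc n)"
  by (simp add: sigma_sum_def)

context
  fixes \<alpha> :: "nat \<Rightarrow> real" and n :: nat
  assumes \<alpha>: "\<And>k. 1 \<le> k \<Longrightarrow> k \<le> n \<Longrightarrow> 0 < \<alpha> k"
begin

lemma sigma_sum_nonneg: "0 \<le> sigma_sum \<alpha> n"
  unfolding sigma_sum_def using \<alpha> by (intro sum_nonneg) (auto intro: less_imp_le)

lemma residual_fun_pos: "0 \<le> t \<Longrightarrow> 0 < residual_fun \<alpha> n t"
  unfolding residual_fun_def using \<alpha> by (intro prod_pos) (auto intro!: divide_pos_pos add_nonneg_pos)

lemma g_fun_residual: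
  assumes "0 \<le> t"
  shows "t * g_fun \<alpha> n t = 1 - residual_fun \<alpha> n t"
proof (cases "t = 0")
  case True
  have "residual_fun \<alpha> n 0 = (\<Prod>k=1..n. 1)"
    unfolding residual_fun_def using \<alpha> by (intro prod.cong) force+
  with True show ?thesis by simp
next
  case False
  then show ?thesis by (simp add: g_fun_def residual_fun_def)
qed

lemma continuous_on_residual_fun: "continuous_on {0..} (residual_fun \<alpha> n)"
  unfolding residual_fun_def
proof (intro continuous_intros ballI)
  fix k t assume "k \<in> {1..n}" "t \<in> {0::real..}"
  with \<alpha>[of k] show "t + \<alpha> k \<noteq> 0" by auto
qed

end

text \<open>A Bernoulli-type inequality: the product of the factors
  \<open>1 + t / \<alpha> k\<close> dominates \<open>1 + \<sigma> t\<close>. The induction step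
  discards only the nonnegative term \<open>?s * t\<^sup>2\<close>.\<close>

lemma residual_fun_bound:
  assumes "\<And>k. 1 \<le> k \<Longrightarrow> k \<le> n \<Longrightarrow> 0 < \<alpha> k" and t: "0 \<le> t"
  shows "residual_fun \<alpha> n t * (1 + sigma_sum \<alpha> n * t) \<le> 1"
  using assms(1)
proof (induction n)
  case (Suc n)
  let ?a = "\<alpha> (Suc n)" and ?s = "sigma_sum \<alpha> n"
  have a: "0 < ?a" and pos: "\<And>k. 1 \<le> k \<Longrightarrow> k \<le> n \<Longrightarrow> 0 < \<alpha> k" using Suc.prems by auto
  have s: "0 \<le> ?s" by (rule sigma_sum_nonneg[where \<alpha> = \<alpha> and n = n, OF pos])
  have "?a / (t + ?a) * (1 + (?s + 1 / ?a) * t) \<le> 1 + ?s * t"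
  proof -
    have "?a * (1 + (?s + 1 / ?a) * t) = ?a + ?s * t * ?a + t" using a by (simp add: field_simps)
    also have "\<dots> \<le> (1 + ?s * t) * (t + ?a)"
      using s t by (simp add: algebra_simps)
    finally show ?thesis using a t by (simp add: divide_le_eq)
  qed
  then have "residual_fun \<alpha> n t * (?a / (t + ?a) * (1 + (?s + 1 / ?a) * t))
      \<le> residual_fun \<alpha> n t * (1 + ?s * t)"
    using residual_fun_pos[where \<alpha> = \<alpha> and n = n, OF pos t] by (intro mult_left_mono) auto
  also have "\<dots> \<le> 1" by (rule Suc.IH[OF pos])
  finally show ?case by (simp add: residual_fun_Suc sigma_sum_Suc mult.assoc)
qed simp

text \<open>This recursion removes the singularity of the defining formula at \<open>0\<close>.\<close>

lemma g_fun_Suc: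
  assumes \<alpha>: "\<And>k. 1 \<le> k \<Longrightarrow> k \<le> Suc n \<Longrightarrow> 0 < \<alpha> k" and t: "0 \<le> t"
  shows "g_fun \<alpha> (Suc n) t = g_fun \<alpha> n t + residual_fun \<alpha> n t / (t + \<alpha> (Suc n))"
proof (cases "t = 0")
  case True
  then have "residual_fun \<alpha> n t = 1"
    using g_fun_residual[of n \<alpha> t] \<alpha> by simp
  with True show ?thesis by (simp add: g_fun_def sigma_sum_Suc)
next
  case False
  have pos: "\<alpha> (Suc n) > 0" using \<alpha> by simp
  have "t * g_fun \<alpha> (Suc n) t = t * g_fun \<alpha> n t + (residual_fun \<alpha> n t - residual_fun \<alpha> (Suc n) t)"
    using g_fun_residual[of "Suc n" \<alpha> t] g_fun_residual[of n \<alpha> t] \<alpha> t by simp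
  also have "residual_fun \<alpha> n t - residual_fun \<alpha> (Suc n) t
      = t * (residual_fun \<alpha> n t / (t + \<alpha> (Suc n)))"
    using pos t by (simp add: residual_fun_Suc field_simps)
  finally have "t * g_fun \<alpha> (Suc n) t = t * (g_fun \<alpha> n t + residual_fun \<alpha> n t / (t + \<alpha> (Suc n)))"
    by (simp only: distrib_left)
  with False show ?thesis by (metis mult_cancel_left)
qed

text \<open>Since the residual is at most \<open>1\<close>, each increment in
  \<open>g_fun_Suc\<close> lies between \<open>0\<close> and \<open>1 / \<alpha> (Suc n)\<close>,
  and these bounds add up to \<open>sigma_sum\<close>.\<close>

lemma g_fun_bounds:
  assumes "\<And>k. 1 \<le> k \<Longrightarrow> k \<le> n \<Longrightarrow> 0 < \<alpha> k" and t: "0 \<le> t"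
  shows "0 \<le> g_fun \<alpha> n t \<and> g_fun \<alpha> n t \<le> sigma_sum \<alpha> n"
  using assms(1)
proof (induction n)
  case 0
  then show ?case by (simp add: g_fun_def)
next
  case (Suc n)
  let ?a = "\<alpha> (Suc n)"
  have a: "0 < ?a" and pos: "\<And>k. 1 \<le> k \<Longrightarrow> k \<le> n \<Longrightarrow> 0 < \<alpha> k" using Suc.prems by auto
  have r: "0 < residual_fun \<alpha> n t" by (rule residual_fun_pos[where \<alpha> = \<alpha> and n = n, OF pos t])
  have "residual_fun \<alpha> n t * 1 \<le> residual_fun \<alpha> n t * (1 + sigma_sum \<alpha> n * t)"
    using r t sigma_sum_nonneg[where \<alpha> = \<alpha> and n = n, OF pos] by (intro mult_left_mono) auto
  with residual_fun_bound[where \<alpha> = \<alpha> and n = n, OF pos t] have "residual_fun \<alpha> n t \<le> 1" by simp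
  with a t have "residual_fun \<alpha> n t / (t + ?a) \<le> 1 / ?a" by (intro frac_le) auto
  moreover have "0 \<le> residual_fun \<alpha> n t / (t + ?a)" using r a t by simp
  ultimately show ?case
    using Suc.IH[OF pos] by (simp add: g_fun_Suc[OF Suc.prems t] sigma_sum_Suc)
qed

lemma continuous_on_g_fun:
  assumes "\<And>k. 1 \<le> k \<Longrightarrow> k \<le> n \<Longrightarrow> 0 < \<alpha> k"
  shows "continuous_on {0..} (g_fun \<alpha> n)"
  using assms
proof (induction n)
  case 0
  have "g_fun \<alpha> 0 = (\<lambda>t. 0)" by (simp add: g_fun_def fun_eq_iff)
  then show ?case by simp
next
  case (Suc n)
  have pos: "\<And>k. 1 \<le> k \<Longrightarrow> k \<le> n \<Longrightarrow> 0 < \<alpha> k" "0 < \<alpha> (Suc n)" using Suc.prems by auto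
  have "continuous_on {0..} (\<lambda>t. g_fun \<alpha> n t + residual_fun \<alpha> n t / (t + \<alpha> (Suc n)))"
    using pos by (intro continuous_intros Suc.IH continuous_on_residual_fun) auto
  then show ?case
    by (rule continuous_on_eq) (use g_fun_Suc[OF Suc.prems] in auto)
qed

section \<open>Error bounds for filter functions of \<open>T\<^sup>*T\<close>\<close>

context
  fixes T :: "'x::{real_inner,banach} \<Rightarrow>\<^sub>L 'y::{real_inner,banach}" and K :: "'x \<Rightarrow>\<^sub>L 'x"
  assumes K_def: "K = hadjoint T o\<^sub>L T"
begin

lemma gram_form: "K x \<bullet> z = T x \<bullet> T z"
  by (metis K_def blinfun_apply_blinfun_compose hadjoint inner_commute)

lemma selfadjoint_gram: "selfadjoint_bounded K"
  unfolding selfadjoint_bounded_def by (metis gram_form inner_commute)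

lemma spectrum_gram: "op_spectrum K \<subseteq> {0..}"
  using spectrum_nonneg[OF selfadjoint_gram] by (auto simp: gram_form)

text \<open>\<open>K\<close> commutes with \<open>f(K)\<close>, so a norm involving \<open>T\<close>
  becomes the quadratic form of a function of \<open>K\<close>.\<close>

lemma norm_gram_op_fun:
  assumes f: "continuous_on (op_spectrum K) f"
  shows "(norm (T (op_fun f K x)))\<^sup>2 = op_fun (\<lambda>t. t * (f t)\<^sup>2) K x \<bullet> x"
proof -
  note sa = selfadjoint_gram
  have "(norm (T (op_fun f K x)))\<^sup>2 = K (op_fun f K x) \<bullet> op_fun f K x"
    by (simp add: power2_norm_eq_inner gram_form)
  also have "\<dots> = op_fun f K (K (op_fun f K x)) \<bullet> x"
    using selfadjointD[OF selfadjoint_op_fun[OF sa f]] by metis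
  also have "op_fun f K (K (op_fun f K x)) = op_fun (\<lambda>t. f t * (t * f t)) K x"
    by (simp add: op_fun_mult[OF sa] op_fun_ident[OF sa] f continuous_on_mult continuous_on_id)
  also have "(\<lambda>t. f t * (t * f t)) = (\<lambda>t. t * (f t)\<^sup>2)"
    by (simp add: fun_eq_iff power2_eq_square)
  finally show ?thesis .
qed

text \<open>The propagated data error: \<open>\<parallel>q\<parallel>\<^sup>2 = (T g(K) q, e)\<close> and \<open>\<parallel>T q\<parallel>\<^sup>2 = (T g(K) K q, e)\<close>.\<close>

lemma data_error_bound:
  fixes g :: "real \<Rightarrow> real" and e :: 'y
  assumes g: "continuous_on (op_spectrum K) g"
    and g_bounds: "\<And>t. 0 \<le> t \<Longrightarrow> 0 \<le> g t \<and> g t \<le> \<sigma> \<and> t * g t \<le> 1"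
  defines "q \<equiv> op_fun g K (hadjoint T e)"
  shows "norm q \<le> sqrt \<sigma> * norm e" "norm (T q) \<le> norm e"
proof -
  note sa = selfadjoint_gram
  have t: "0 \<le> t" if "t \<in> op_spectrum K" for t using spectrum_gram that by auto
  have dual: "z \<bullet> q = T (op_fun g K z) \<bullet> e" for z
    unfolding q_def using selfadjointD[OF selfadjoint_op_fun[OF sa g]] hadjoint by metis
  \<comment> \<open>The chain \<open>t g(t)\<^sup>2 \<le> g(t) \<le> \<sigma>\<close> bounds
    \<open>T g(K)\<close> by \<open>sqrt \<sigma>\<close>.\<close>
  have "(norm (T (op_fun g K q)))\<^sup>2 \<le> op_fun (\<lambda>t. \<sigma>) K q \<bullet> q"
    unfolding norm_gram_op_fun[OF g]
  proof (intro op_fun_mono[OF sa] continuous_intros g)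
    fix t assume "t \<in> op_spectrum K"
    note b = g_bounds[OF t[OF this]]
    then have "t * g t * g t \<le> 1 * g t" by (intro mult_right_mono) auto
    with b show "t * (g t)\<^sup>2 \<le> \<sigma>" by (simp add: power2_eq_square mult.assoc)
  qed
  also have "\<dots> = (sqrt \<sigma> * norm q)\<^sup>2"
    using g_bounds[of 0]
    by (simp add: op_fun_const[OF sa] power_mult_distrib blinfun.bilinear_simps power2_norm_eq_inner)
  finally have "norm (T (op_fun g K q)) \<le> sqrt \<sigma> * norm q"
    by (rule power2_le_imp_le) (use g_bounds[of 0] in auto)
  then have "norm (T (op_fun g K q)) * norm e \<le> (sqrt \<sigma> * norm q) * norm e"
    by (rule mult_right_mono) simp
  then have "norm q * norm q \<le> norm q * (sqrt \<sigma> * norm e)"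
    using norm_cauchy_schwarz[of "T (op_fun g K q)" e] dual[of q]
    by (simp add: power2_norm_eq_inner[symmetric] power2_eq_square mult_ac)
  then show "norm q \<le> sqrt \<sigma> * norm e"
    by (cases "norm q = 0") (use g_bounds[of 0] in \<open>auto dest: mult_left_le_imp_le\<close>)
  have gK: "op_fun g K (K q) = op_fun (\<lambda>t. g t * t) K q"
    by (simp add: op_fun_mult[OF sa g continuous_on_id] op_fun_ident[OF sa])
  \<comment> \<open>Here \<open>t (t g(t))\<^sup>2 \<le> t\<close>, and the form of \<open>K\<close>
    at \<open>q\<close> is the square of \<open>norm (T q)\<close>.\<close>
  have "(norm (T (op_fun g K (K q))))\<^sup>2 \<le> op_fun (\<lambda>t. t) K q \<bullet> q"
    unfolding gK norm_gram_op_fun[OF continuous_on_mult[OF g continuous_on_id]]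
  proof (intro op_fun_mono[OF sa] continuous_intros g)
    fix t assume "t \<in> op_spectrum K"
    note b = t[OF this] g_bounds[OF t[OF this]]
    then have "(g t * t)\<^sup>2 \<le> 1\<^sup>2" by (intro power_mono) (auto simp: mult.commute)
    with b show "t * (g t * t)\<^sup>2 \<le> t" by (simp add: mult_left_le)
  qed
  also have "\<dots> = (norm (T q))\<^sup>2"
    by (simp add: op_fun_ident[OF sa] gram_form power2_norm_eq_inner)
  finally have "norm (T (op_fun g K (K q))) \<le> norm (T q)"
    by (rule power2_le_imp_le) simp
  then have "norm (T (op_fun g K (K q))) * norm e \<le> norm (T q) * norm e"
    by (rule mult_right_mono) simp
  then have "norm (T q) * norm (T q) \<le> norm (T q) * norm e"
    using norm_cauchy_schwarz[of "T (op_fun g K (K q))" e] dual[of "K q"]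
    by (simp add: gram_form power2_norm_eq_inner[symmetric] power2_eq_square)
  then show "norm (T q) \<le> norm e"
    by (cases "norm (T q) = 0") (auto dest: mult_left_le_imp_le)
qed

text \<open>Duality again: \<open>\<parallel>q\<parallel>\<^sup>2 = (W r(K) q, v)\<close> and
  \<open>\<parallel>T q\<parallel>\<^sup>2 = (W r(K) K q, v)\<close>. \<open>W_bound\<close> is the
  form inequality \<open>W\<^sup>2 \<le> h\<^sup>2 (1 + \<sigma> K)\<close>, whose factor
  \<open>1 + \<sigma> t\<close> one of the two factors \<open>r\<close> absorbs.\<close>

lemma approximation_error_bound:
  fixes r :: "real \<Rightarrow> real" and W :: "'x \<Rightarrow>\<^sub>L 'x" and v :: 'x
  assumes r: "continuous_on (op_spectrum K) r"
    and r_bounds: "\<And>t. 0 \<le> t \<Longrightarrow> 0 \<le> r t \<and> r t * (1 + \<sigma> * t) \<le> 1"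
    and "0 < \<sigma>" "0 \<le> h"
    and W: "selfadjoint_bounded W"
    and W_bound: "\<And>x. (norm (W x))\<^sup>2 \<le> h\<^sup>2 * ((norm x)\<^sup>2 + \<sigma> * (norm (T x))\<^sup>2)"
  defines "q \<equiv> op_fun r K (W v)"
  shows "norm q \<le> h * norm v" "sqrt \<sigma> * norm (T q) \<le> h * norm v"
proof -
  note sa = selfadjoint_gram
  have t: "0 \<le> t" if "t \<in> op_spectrum K" for t using spectrum_gram that by auto
  have dual: "z \<bullet> q = W (op_fun r K z) \<bullet> v" for z
    unfolding q_def using selfadjointD[OF selfadjoint_op_fun[OF sa r]] selfadjointD[OF W] by metis
  \<comment> \<open>On vectors \<open>f(K) x\<close> the right-hand side of \<open>W_bound\<close>
    is the form of \<open>(1 + \<sigma> t) f(t)\<^sup>2\<close> at \<open>K\<close>, which any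
    larger function \<open>u\<close> may replace.\<close>
  have W_f: "(norm (W (op_fun f K x)))\<^sup>2 \<le> h\<^sup>2 * (op_fun u K x \<bullet> x)"
    if f: "continuous_on (op_spectrum K) f" and u: "continuous_on (op_spectrum K) u"
      and fu: "\<And>t. 0 \<le> t \<Longrightarrow> (1 + \<sigma> * t) * (f t)\<^sup>2 \<le> u t" for f u x
  proof -
    have "(norm (op_fun f K x))\<^sup>2 + \<sigma> * (norm (T (op_fun f K x)))\<^sup>2
        = op_fun (\<lambda>t. (f t)\<^sup>2 + \<sigma> * (t * (f t)\<^sup>2)) K x \<bullet> x"
      unfolding norm_op_fun_power2[OF sa f] norm_gram_op_fun[OF f]
      by (simp add: op_fun_add[OF sa] op_fun_cmult[OF sa] continuous_intros f
          blinfun.bilinear_simps inner_add_left)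
    also have "\<dots> \<le> op_fun u K x \<bullet> x"
    proof (intro op_fun_mono[OF sa] continuous_intros f u)
      show "(f t)\<^sup>2 + \<sigma> * (t * (f t)\<^sup>2) \<le> u t" if "t \<in> op_spectrum K" for t
        using fu[OF t[OF that]] by (simp add: algebra_simps)
    qed
    finally show ?thesis
      using W_bound[of "op_fun f K x"] by (meson mult_left_mono order_trans zero_le_power2)
  qed
  have r2: "(1 + \<sigma> * t) * (r t)\<^sup>2 \<le> r t" "r t \<le> 1" "\<sigma> * t * r t \<le> 1" if "0 \<le> t" for t
  proof -
    have b: "0 \<le> r t" "r t * (1 + \<sigma> * t) \<le> 1" using r_bounds[OF that] by auto
    then have "r t * (1 + \<sigma> * t) * r t \<le> 1 * r t" by (intro mult_right_mono)
    then show "(1 + \<sigma> * t) * (r t)\<^sup>2 \<le> r t" by (simp add: power2_eq_square mult_ac)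
    have "0 \<le> \<sigma> * t * r t" using b that \<open>0 < \<sigma>\<close> by simp
    with b show "r t \<le> 1" "\<sigma> * t * r t \<le> 1" by (auto simp: algebra_simps)
  qed
  have "(norm (W (op_fun r K q)))\<^sup>2 \<le> h\<^sup>2 * (op_fun (\<lambda>t. 1) K q \<bullet> q)"
    using r2 by (intro W_f r continuous_intros) (meson order_trans)
  also have "\<dots> = (h * norm q)\<^sup>2"
    by (simp add: op_fun_const[OF sa] power_mult_distrib power2_norm_eq_inner)
  finally have "norm (W (op_fun r K q)) \<le> h * norm q"
    by (rule power2_le_imp_le) (use \<open>0 \<le> h\<close> in simp)
  then have "norm (W (op_fun r K q)) * norm v \<le> (h * norm q) * norm v"
    by (rule mult_right_mono) simp
  then have "norm q * norm q \<le> norm q * (h * norm v)"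
    using norm_cauchy_schwarz[of "W (op_fun r K q)" v] dual[of q]
    by (simp add: power2_norm_eq_inner[symmetric] power2_eq_square mult_ac)
  then show "norm q \<le> h * norm v"
    by (cases "norm q = 0") (use \<open>0 \<le> h\<close> in \<open>auto dest: mult_left_le_imp_le\<close>)
  have rK: "op_fun r K (K q) = op_fun (\<lambda>t. r t * t) K q"
    by (simp add: op_fun_mult[OF sa r continuous_on_id] op_fun_ident[OF sa])
  \<comment> \<open>The estimate used is \<open>(1 + \<sigma> t) (r(t) t)\<^sup>2 \<le> r(t)
    t\<^sup>2 \<le> t / \<sigma>\<close>, whose last term at \<open>K\<close> is again a multiple of
    the form of \<open>T q\<close>.\<close>
  have "(norm (W (op_fun r K (K q))))\<^sup>2 \<le> h\<^sup>2 * (op_fun (\<lambda>t. inverse \<sigma> * t) K q \<bullet> q)"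
    unfolding rK
  proof (intro W_f continuous_intros r)
    fix t :: real assume "0 \<le> t"
    note b = r2[OF this] r_bounds[OF this]
    have "(1 + \<sigma> * t) * (r t)\<^sup>2 * t\<^sup>2 \<le> r t * t\<^sup>2" by (intro mult_right_mono b) simp
    also have "\<dots> = inverse \<sigma> * t * (\<sigma> * t * r t)"
      using \<open>0 < \<sigma>\<close> by (simp add: power2_eq_square)
    also have "\<dots> \<le> inverse \<sigma> * t * 1"
      using \<open>0 < \<sigma>\<close> \<open>0 \<le> t\<close> b by (intro mult_left_mono) auto
    finally show "(1 + \<sigma> * t) * (r t * t)\<^sup>2 \<le> inverse \<sigma> * t"
      by (simp add: power_mult_distrib mult_ac)
  qed
  also have "op_fun (\<lambda>t. inverse \<sigma> * t) K q \<bullet> q = inverse \<sigma> * (norm (T q))\<^sup>2"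
    by (simp add: op_fun_cmult[OF sa continuous_on_id] op_fun_ident[OF sa]
        gram_form blinfun.bilinear_simps power2_norm_eq_inner)
  also have "h\<^sup>2 * (inverse \<sigma> * (norm (T q))\<^sup>2) = (h * norm (T q) / sqrt \<sigma>)\<^sup>2"
    using \<open>0 < \<sigma>\<close> by (simp add: power_mult_distrib divide_inverse power_inverse mult_ac)
  finally have "norm (W (op_fun r K (K q))) \<le> h * norm (T q) / sqrt \<sigma>"
    by (rule power2_le_imp_le) (use \<open>0 \<le> h\<close> \<open>0 < \<sigma>\<close> in simp)
  then have "norm (W (op_fun r K (K q))) * norm v \<le> (h * norm (T q) / sqrt \<sigma>) * norm v"
    by (rule mult_right_mono) simp
  then have "norm (T q) * norm (T q) \<le> (h * norm (T q) / sqrt \<sigma>) * norm v"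
    using norm_cauchy_schwarz[of "W (op_fun r K (K q))" v] dual[of "K q"]
    by (simp add: gram_form power2_norm_eq_inner[symmetric] power2_eq_square)
  then have "norm (T q) * (sqrt \<sigma> * norm (T q)) \<le> norm (T q) * (h * norm v)"
    using \<open>0 < \<sigma>\<close> by (simp add: field_simps)
  then show "sqrt \<sigma> * norm (T q) \<le> h * norm v"
    by (cases "norm (T q) = 0") (use \<open>0 \<le> h\<close> in \<open>auto dest: mult_left_le_imp_le\<close>)
qed

end

section \<open>Powers and index functions of a positive operator\<close>

definition real_power :: "real \<Rightarrow> real \<Rightarrow> real"
  where "real_power s t = (if s = 0 then 1 else t powr s)"

lemma real_power_pos_eq: "0 < t \<Longrightarrow> real_power s t = t powr s"
  by (simp add: real_power_def)

lemma op_power_eq: "op_power G s = op_fun (real_power s) G"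
  by (simp add: op_power_def real_power_def[abs_def])

lemma op_power_zero: "selfadjoint_bounded G \<Longrightarrow> op_power G 0 = id_blinfun"
  by (simp add: op_power_def op_fun_const)

text \<open>Nonnegative exponents exclude \<open>s + r = 0\<close> with \<open>s \<noteq> 0\<close>,
  where the convention at \<open>t = 0\<close> would break the law.\<close>

lemma real_power_add: "0 \<le> s \<Longrightarrow> 0 \<le> r \<Longrightarrow> real_power (s + r) t = real_power s t * real_power r t"
  by (auto simp: real_power_def powr_add)

lemma continuous_on_real_power:
  assumes "0 \<le> s"
  shows "continuous_on {0..} (real_power s)"
proof (cases "s = 0")
  case False
  with assms have "0 < s" by simp
  then have "continuous_on {0..} (\<lambda>t::real. t powr s)"
    by (intro continuous_on_powr' continuous_on_id continuous_on_const) auto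
  with False show ?thesis by (simp add: real_power_def[abs_def])
qed (simp add: real_power_def[abs_def])

lemma op_power_add:
  assumes sa: "selfadjoint_bounded G" and "op_spectrum G \<subseteq> {0..}" and "0 \<le> s" "0 \<le> r"
  shows "op_power G (s + r) = op_power G s o\<^sub>L op_power G r"
proof -
  have "continuous_on (op_spectrum G) (real_power s)" "continuous_on (op_spectrum G) (real_power r)"
    using assms continuous_on_real_power continuous_on_subset by blast+
  from op_fun_mult[OF sa this] show ?thesis
    by (simp add: op_power_eq real_power_add[OF assms(3,4), abs_def])
qed

section \<open>The inverse of \<open>B\<close> as a positive bounded operator\<close>

lemma inverse_operator_selfadjoint:
  assumes "densely_defined_selfadjoint D B" "is_inverse_operator D B G"
  shows "selfadjoint_bounded G"
  using assms unfolding selfadjoint_bounded_def densely_defined_selfadjoint_def is_inverse_operator_def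
  by metis

lemma inverse_operator_nonneg:
  assumes "strictly_positive_definite D B" "is_inverse_operator D B G"
  shows "0 \<le> G x \<bullet> x"
proof -
  obtain \<gamma> where "\<gamma> > 0" "\<And>u. u \<in> D \<Longrightarrow> \<gamma> * (norm u)\<^sup>2 \<le> B u \<bullet> u"
    using assms(1) unfolding strictly_positive_definite_def by blast
  with assms(2) have "\<gamma> * (norm (G x))\<^sup>2 \<le> x \<bullet> G x" "\<gamma> > 0"
    unfolding is_inverse_operator_def by metis+
  then show ?thesis by (metis inner_commute mult_nonneg_nonneg order_trans less_imp_le zero_le_power2)
qed

section \<open>Index functions and interpolation in the scale of powers of \<open>G\<close>\<close>

context
  fixes a :: real and \<rho> :: "real \<Rightarrow> real"
  assumes index: "index_function a \<rho>"
begin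

lemma index_function_pos: "0 < t \<Longrightarrow> t \<le> a \<Longrightarrow> 0 < \<rho> t"
  using index by (auto simp: index_function_def image_subset_iff)

lemma psi_pos: "0 < t \<Longrightarrow> t \<le> a \<Longrightarrow> 0 < psi \<rho> r t"
  using index_function_pos by (simp add: psi_def)

lemma psi_strict_mono:
  assumes "0 \<le> r" "0 < t" "t < u" "u \<le> a"
  shows "psi \<rho> r t < psi \<rho> r u"
proof -
  have "\<rho> t < \<rho> u"
    using index assms by (auto simp: index_function_def strict_mono_on_def)
  moreover have "t powr r \<le> u powr r" using assms by (intro powr_mono2) auto
  ultimately show ?thesis
    unfolding psi_def using index_function_pos[of t] assms
    by (intro mult_le_less_imp_less) auto
qed

lemma psi_inv_psi:
  assumes "0 \<le> r" "0 < t" "t \<le> a"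
  shows "psi_inv a \<rho> r (psi \<rho> r t) = t"
  unfolding psi_inv_def
proof (rule the_inv_into_f_f)
  show "inj_on (psi \<rho> r) {0<..a}"
    using psi_strict_mono[OF assms(1)] by (intro linorder_inj_onI) (auto simp: less_le)
qed (use assms in auto)

text \<open>At \<open>0\<close> this is the limit condition of an index function; at
  \<open>x > 0\<close> the half-open and the closed interval have the same neighbourhoods.\<close>

lemma continuous_on_extend0: "continuous_on {0..a} (extend0 \<rho>)"
proof (cases "0 < a")
  case True
  show ?thesis unfolding continuous_on_def
  proof
    fix x assume x: "x \<in> {0..a}"
    show "(extend0 \<rho> \<longlongrightarrow> extend0 \<rho> x) (at x within {0..a})"
    proof (cases "x = 0")
      case 0: True
      have "(\<rho> \<longlongrightarrow> 0) (at_right 0)" using index by (simp add: index_function_def)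
      then have "(extend0 \<rho> \<longlongrightarrow> 0) (at_right 0)"
        by (rule Lim_transform_eventually)
           (auto simp: extend0_def eventually_at_filter)
      then show ?thesis using 0 True by (simp add: extend0_def at_within_Icc_at_right)
    next
      case False
      have "(\<rho> \<longlongrightarrow> \<rho> x) (at x within {0<..a})"
        using index x False by (auto simp: index_function_def continuous_on_def)
      then have "(extend0 \<rho> \<longlongrightarrow> \<rho> x) (at x within {0<..a})"
        by (rule Lim_transform_eventually)
           (auto simp: extend0_def eventually_at_filter)
      moreover have "at x within {0<..a} = at x within {0..a}"
        using x False by (intro at_within_nhd[of _ "{0<..}"]) auto
      ultimately show ?thesis using x False by (simp add: extend0_def)
    qed
  qed
next
  case False
  then have "{0..a} = {} \<or> {0..a} = {0}" by auto
  then show ?thesis by auto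
qed

lemma continuous_on_psi_extended:
  assumes "0 \<le> s"
  shows "continuous_on {0..a} (\<lambda>t. extend0 \<rho> t * real_power s t)"
  by (intro continuous_on_mult continuous_on_extend0
      continuous_on_subset[OF continuous_on_real_power[OF assms]]) auto

lemma psi_eq_extended: "0 < t \<Longrightarrow> psi \<rho> s t = extend0 \<rho> t * real_power s t"
  by (simp add: psi_def extend0_def real_power_pos_eq)

text \<open>A supporting line of slope \<open>k\<close> to \<open>xi_fun \<rho> s\<close>, with the
  variable \<open>t powr (2 * s)\<close> substituted; \<open>L < a\<close> makes the point of
  contact interior. The sign of the constant term is the inequality at \<open>t = 0\<close>, and it
  forces \<open>k\<close> to be positive.\<close>

lemma xi_fun_tangent:
  assumes convex: "convex_on {0<..a powr (2 * s)} (xi_fun \<rho> s)"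
    and s: "0 < s" and L: "0 < L" "L < a"
  obtains k where "0 < k"
    "\<And>t. 0 \<le> t \<Longrightarrow> t \<le> a \<Longrightarrow>
      k * (real_power s t)\<^sup>2 \<le> (extend0 \<rho> t * real_power s t)\<^sup>2 + (k * (L powr s)\<^sup>2 - (psi \<rho> s L)\<^sup>2)"
    "0 \<le> k * (L powr s)\<^sup>2 - (psi \<rho> s L)\<^sup>2"
proof -
  let ?I = "{0<..a powr (2 * s)}" and ?x = "L powr (2 * s)"
  \<comment> \<open>The right derivative at \<open>?x\<close>, written as the infimum of difference
    quotients that \<open>convex_le_Inf_differential\<close> expects.\<close>
  define k where "k = Inf ((\<lambda>t. (xi_fun \<rho> s ?x - xi_fun \<rho> s t) / (?x - t)) ` ({?x<..} \<inter> ?I))"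
  have double: "t powr (2 * s) = (t powr s)\<^sup>2" for t :: real
    by (simp add: power2_eq_square powr_add[symmetric])
  have xi: "xi_fun \<rho> s (t powr (2 * s)) = (psi \<rho> s t)\<^sup>2" if "0 < t" for t
    using that s by (simp add: xi_fun_def powr_powr)
  have x: "?x \<in> interior ?I"
    using L s by (simp add: powr_less_mono2)
  define F where "F t = (extend0 \<rho> t * real_power s t)\<^sup>2 - k * (real_power s t)\<^sup>2" for t
  have F_pos: "(psi \<rho> s L)\<^sup>2 - k * (L powr s)\<^sup>2 \<le> F t" if "t \<in> {0<..a}" for t
  proof -
    have "t powr (2 * s) \<in> ?I" using that s by (auto intro!: powr_mono2)
    from convex_le_Inf_differential[OF convex x this]
    have "(psi \<rho> s L)\<^sup>2 + k * (t powr (2 * s) - L powr (2 * s)) \<le> (psi \<rho> s t)\<^sup>2"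
      using that L unfolding k_def by (simp add: xi)
    moreover have "F t = (psi \<rho> s t)\<^sup>2 - k * (t powr s)\<^sup>2"
      using that by (simp add: F_def psi_eq_extended real_power_pos_eq)
    ultimately show ?thesis unfolding double by (simp add: algebra_simps)
  qed
  \<comment> \<open>Continuity of \<open>F\<close> carries the inequality to \<open>t = 0\<close>,
    which lies outside the interval of convexity but may belong to the spectrum.\<close>
  have F: "(psi \<rho> s L)\<^sup>2 - k * (L powr s)\<^sup>2 \<le> F t" if "0 \<le> t" "t \<le> a" for t
  proof (rule continuous_ge_on_closure[of "{0<..a}" F])
    have cl: "closure {0<..a} = {0..a}" using L by simp
    show "continuous_on (closure {0<..a}) F"
      unfolding F_def cl using s
      by (intro continuous_intros continuous_on_psi_extended
          continuous_on_subset[OF continuous_on_real_power]) auto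
    show "t \<in> closure {0<..a}" unfolding cl using that by simp
  qed (rule F_pos)
  have k0: "0 \<le> k * (L powr s)\<^sup>2 - (psi \<rho> s L)\<^sup>2"
    using F[of 0] L s by (simp add: F_def real_power_def)
  moreover have "0 < (psi \<rho> s L)\<^sup>2" using psi_pos[of L s] L by simp
  ultimately have "0 < k * (L powr s)\<^sup>2" by linarith
  then have "0 < k" by (simp add: zero_less_mult_iff)
  moreover have "k * (real_power s t)\<^sup>2
      \<le> (extend0 \<rho> t * real_power s t)\<^sup>2 + (k * (L powr s)\<^sup>2 - (psi \<rho> s L)\<^sup>2)"
    if "0 \<le> t" "t \<le> a" for t
    using F[OF that] by (simp add: F_def)
  ultimately show thesis using k0 that by blast
qed

text \<open>The tangent to \<open>\<xi>\<^sub>s\<close> at \<open>L\<^sup>2\<^sup>s\<close> replaces Jensen's inequality for the spectral measure.\<close>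

lemma interpolation:
  fixes G :: "'x::{real_inner,banach} \<Rightarrow>\<^sub>L 'x"
  assumes sa: "selfadjoint_bounded G" and spec: "op_spectrum G \<subseteq> {0..a}"
    and "0 \<le> s" and L: "0 < L" "L \<le> a"
    and convex: "0 < s \<Longrightarrow> convex_on {0<..a powr (2 * s)} (xi_fun \<rho> s)"
    and z: "norm z \<le> C" and Gz: "norm (op_fun (extend0 \<rho>) G (op_power G s z)) \<le> C * psi \<rho> s L"
  shows "norm (op_power G s z) \<le> C * L powr s"
proof -
  have C: "0 \<le> C" using norm_ge_zero z by (rule order_trans)
  have cont: "continuous_on (op_spectrum G) (real_power s)"
    "continuous_on (op_spectrum G) (\<lambda>t. extend0 \<rho> t * real_power s t)"
    "continuous_on (op_spectrum G) (extend0 \<rho>)"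
    using continuous_on_real_power[OF \<open>0 \<le> s\<close>] continuous_on_psi_extended[OF \<open>0 \<le> s\<close>]
      continuous_on_extend0 spec
    by (auto elim!: continuous_on_subset)
  \<comment> \<open>For \<open>L = a\<close> the contact point is an endpoint and has no tangent
    from the lemma; there \<open>norm (op_power G s) \<le> a powr s\<close> suffices.\<close>
  consider "s = 0" | "0 < s" "L = a" | "0 < s" "L < a" using \<open>0 \<le> s\<close> L by linarith
  then show ?thesis
  proof cases
    case 1
    then show ?thesis using z L op_power_zero[OF sa] by simp
  next
    case 2
    have "norm (op_power G s) \<le> a powr s"
      unfolding op_power_eq
      using spec 2 by (intro norm_op_fun_le[OF sa cont(1)]) (auto simp: real_power_def intro!: powr_mono2)
    then have "norm (op_power G s z) \<le> a powr s * C"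
      using norm_blinfun[of "op_power G s" z] z by (meson mult_mono norm_ge_zero order_trans powr_ge_zero)
    with 2 show ?thesis by (simp add: mult.commute)
  next
    case 3
    then obtain k where k: "0 < k" and tangent: "\<And>t. 0 \<le> t \<Longrightarrow> t \<le> a \<Longrightarrow>
        k * (real_power s t)\<^sup>2 \<le> (extend0 \<rho> t * real_power s t)\<^sup>2 + (k * (L powr s)\<^sup>2 - (psi \<rho> s L)\<^sup>2)"
      and k0: "0 \<le> k * (L powr s)\<^sup>2 - (psi \<rho> s L)\<^sup>2"
      using xi_fun_tangent[OF convex] L by metis
    let ?c = "k * (L powr s)\<^sup>2 - (psi \<rho> s L)\<^sup>2"
    have "k * (norm (op_power G s z))\<^sup>2 = op_fun (\<lambda>t. k * (real_power s t)\<^sup>2) G z \<bullet> z"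
      by (simp add: op_power_eq norm_op_fun_power2[OF sa cont(1)] op_fun_cmult[OF sa]
          continuous_on_power cont blinfun.bilinear_simps)
    also have "\<dots> \<le> op_fun (\<lambda>t. (extend0 \<rho> t * real_power s t)\<^sup>2 + ?c) G z \<bullet> z"
      using tangent spec
      by (intro op_fun_mono[OF sa] continuous_on_add continuous_on_mult continuous_on_power cont
          continuous_on_const) auto
    also have "\<dots> = (norm (op_fun (extend0 \<rho>) G (op_power G s z)))\<^sup>2 + ?c * (norm z)\<^sup>2"
      using norm_op_fun_power2[OF sa cont(2), of z]
      by (simp add: op_fun_add[OF sa] op_fun_const[OF sa] continuous_on_power cont continuous_on_const
          blinfun.bilinear_simps inner_add_left op_fun_mult[OF sa cont(3,1)] op_power_eq
          power2_norm_eq_inner[of z])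
    \<comment> \<open>\<open>k0\<close> allows \<open>norm z\<close> to be replaced by
      \<open>C\<close>; the two \<open>psi\<close> terms then cancel.\<close>
    also have "\<dots> \<le> (C * psi \<rho> s L)\<^sup>2 + ?c * C\<^sup>2"
      using Gz z k0 by (intro add_mono power_mono mult_left_mono) auto
    also have "\<dots> = k * (C * L powr s)\<^sup>2" by (simp add: algebra_simps)
    finally have "(norm (op_power G s z))\<^sup>2 \<le> (C * L powr s)\<^sup>2" using k by simp
    then show ?thesis by (rule power2_le_imp_le) (use C in simp)
  qed
qed

text \<open>For \<open>t \<le> L\<close> the first summand suffices, by monotonicity of the power.
  For \<open>t > L\<close> the second does: at \<open>(psi \<rho> s u)\<^sup>2\<close> the
  decreasing function equals \<open>u powr (p - s) / psi \<rho> s u\<close>, which is compared at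
  \<open>L\<close> and \<open>t\<close>.\<close>

lemma source_index_bound:
  assumes sp: "0 \<le> s" "s \<le> p"
    and decreasing: "antimono_on {0<..(psi \<rho> s a)\<^sup>2} (\<lambda>t. h_fun a \<rho> s p t / sqrt t)"
    and L: "0 < L" "L \<le> a" and t: "0 \<le> t" "t \<le> a"
  shows "(real_power (p - s) t)\<^sup>2
    \<le> (L powr (p - s))\<^sup>2 + (L powr (p - s) / psi \<rho> s L)\<^sup>2 * (extend0 \<rho> t * real_power s t)\<^sup>2"
proof (cases "t \<le> L")
  case True
  have "real_power (p - s) t \<le> L powr (p - s)"
    using t sp L True by (auto simp: real_power_def intro!: powr_mono2)
  then have "(real_power (p - s) t)\<^sup>2 \<le> (L powr (p - s))\<^sup>2"
    by (intro power_mono) (auto simp: real_power_def)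
  then show ?thesis by (simp add: add_increasing2)
next
  case False
  with L have t0: "0 < t" by simp
  have h: "h_fun a \<rho> s p ((psi \<rho> s u)\<^sup>2) / sqrt ((psi \<rho> s u)\<^sup>2) = u powr (p - s) / psi \<rho> s u"
    if "0 < u" "u \<le> a" for u
    using psi_pos[OF that, of s] psi_inv_psi[OF sp(1) that] by (simp add: h_fun_def)
  have le: "psi \<rho> s u \<le> psi \<rho> s w" if "0 < u" "u \<le> w" "w \<le> a" for u w
    using psi_strict_mono[OF sp(1), of u w] that by (cases "u = w") auto
  have mem: "(psi \<rho> s u)\<^sup>2 \<in> {0<..(psi \<rho> s a)\<^sup>2}" if "0 < u" "u \<le> a" for u
    using le[OF that order_refl] psi_pos[OF that, of s] by (auto intro: power_mono)
  have "(psi \<rho> s L)\<^sup>2 \<le> (psi \<rho> s t)\<^sup>2"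
    using le[OF L(1) _ t(2)] False psi_pos[OF L, of s] by (intro power_mono) auto
  then have "h_fun a \<rho> s p ((psi \<rho> s t)\<^sup>2) / sqrt ((psi \<rho> s t)\<^sup>2)
      \<le> h_fun a \<rho> s p ((psi \<rho> s L)\<^sup>2) / sqrt ((psi \<rho> s L)\<^sup>2)"
    by (rule monotone_onD[OF decreasing mem[OF L] mem[OF t0 t(2)]])
  then have "t powr (p - s) / psi \<rho> s t \<le> L powr (p - s) / psi \<rho> s L"
    using h L t t0 by simp
  then have "t powr (p - s) \<le> L powr (p - s) / psi \<rho> s L * psi \<rho> s t"
    using psi_pos[OF t0 t(2), of s] by (simp add: pos_divide_le_eq)
  then have "(t powr (p - s))\<^sup>2 \<le> (L powr (p - s) / psi \<rho> s L * psi \<rho> s t)\<^sup>2"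
    by (intro power_mono) auto
  also have "\<dots> = (L powr (p - s) / psi \<rho> s L)\<^sup>2 * (extend0 \<rho> t * real_power s t)\<^sup>2"
    unfolding psi_eq_extended[OF t0] by (rule power_mult_distrib)
  finally show ?thesis
    unfolding real_power_pos_eq[OF t0, of "p - s"] by (rule add_increasing[OF zero_le_power2])
qed

end

section \<open>The error estimate\<close>

theorem theorem3p9:
  fixes A :: "'x::{real_inner,banach} \<Rightarrow>\<^sub>L 'y::{real_inner,banach}"
    and D :: "'x set" and B :: "'x \<Rightarrow> 'x" and G :: "'x \<Rightarrow>\<^sub>L 'x"
    and y y\<^sub>\<delta> :: 'y and x\<^sub>0 xdag v :: 'x
    and \<rho> :: "real \<Rightarrow> real" and \<alpha> :: "nat \<Rightarrow> real" and n :: nat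
    and a \<delta> s p m E :: real
  assumes A_inj: "inj (blinfun_apply A)"
    and A_range: "\<not> closed (range (blinfun_apply A))"
    and exact_solution: "A xdag = y"
    and noise: "norm (y - y\<^sub>\<delta>) \<le> \<delta>"
    and B_selfadjoint: "densely_defined_selfadjoint D B"
    and B_unbounded: "unbounded_on D B"
    and B_positive: "strictly_positive_definite D B"
    and G_def: "is_inverse_operator D B G"
    and a_def: "a = norm G"
    and rho_index: "index_function a \<rho>"
    and s_p: "0 \<le> s" "s \<le> p"
    and constants_pos: "0 < p" "0 < E" "0 < m"
    and n_pos: "1 \<le> n"
    and alpha_pos: "\<And>k. 1 \<le> k \<Longrightarrow> k \<le> n \<Longrightarrow> 0 < \<alpha> k"
    and in_domain: "\<delta> / (m * E) \<in> psi \<rho> p ` {0<..a}"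
    and sigma_choice:
      "inverse (sigma_sum \<alpha> n) = \<delta>\<^sup>2 / E\<^sup>2 * psi_inv a \<rho> p (\<delta> / (m * E)) powr (2 * (s - p))"
    and link: "\<And>x. m * norm (op_fun (extend0 \<rho>) G x) \<le> norm (A x)"
    and source: "xdag - x\<^sub>0 = op_power G p v" "norm v \<le> E"
    and h_monotone:
      "operator_monotone TYPE('x) ((psi \<rho> s a)\<^sup>2) (\<lambda>t. (h_fun a \<rho> s p t)\<^sup>2)"
    and h_decreasing: "antimono_on {0<..(psi \<rho> s a)\<^sup>2} (\<lambda>t. h_fun a \<rho> s p t / sqrt t)"
    and xi_convex: "0 < s \<Longrightarrow> convex_on {0<..a powr (2 * s)} (xi_fun \<rho> s)"
  shows "norm (regularized_solution A G s \<alpha> n x\<^sub>0 y\<^sub>\<delta> - xdag)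
           \<le> 2 * E * psi_inv a \<rho> p (\<delta> / (m * E)) powr p"
proof -

  \<comment> \<open>Spectrum of \<open>G\<close> and the parameter choice\<close>
  have saG: "selfadjoint_bounded G"
    by (rule inverse_operator_selfadjoint[OF B_selfadjoint G_def])
  have specG: "op_spectrum G \<subseteq> {0..a}"
    using spectrum_nonneg[OF saG inverse_operator_nonneg[OF B_positive G_def]]
      spectrum_le_norm[OF saG] a_def by force
  then have specG': "op_spectrum G \<subseteq> {0..}" by auto
  \<comment> \<open>\<open>in_domain\<close> makes the value of \<open>psi_inv\<close> a genuine
    preimage; \<open>L\<close> is the \<open>\<lambda>\<close> of the outline.\<close>
  obtain L where L: "0 < L" "L \<le> a" and psi_L: "psi \<rho> p L = \<delta> / (m * E)"
    using in_domain by auto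
  have psi_inv: "psi_inv a \<rho> p (\<delta> / (m * E)) = L"
    using psi_inv_psi[OF rho_index _ L, of p] constants_pos by (simp add: psi_L)
  define h where "h = L powr (p - s)"
  have h: "0 < h" using L by (simp add: h_def)
  have Lp: "L powr p = h * L powr s" by (simp add: h_def powr_add[symmetric])
  have psi_s: "0 < psi \<rho> s L" by (rule psi_pos[OF rho_index L])
  \<comment> \<open>By \<open>Lp\<close>,
    \<open>psi \<rho> p L = h * psi \<rho> s L\<close>.\<close>
  have delta: "\<delta> = m * E * h * psi \<rho> s L"
    using psi_L constants_pos by (simp add: psi_def Lp field_simps)
  define \<sigma> where "\<sigma> = sigma_sum \<alpha> n"
  have "L powr (2 * (s - p)) = inverse (h\<^sup>2)"
    by (simp add: h_def power2_eq_square powr_add[symmetric] powr_minus[symmetric] algebra_simps)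
  \<comment> \<open>Inserting \<open>delta\<close> into \<open>sigma_choice\<close> cancels both
    \<open>E\<close> and \<open>h\<close>.\<close>
  then have "inverse \<sigma> = (m * psi \<rho> s L)\<^sup>2"
    using sigma_choice h constants_pos unfolding psi_inv \<sigma>_def[symmetric]
    by (simp add: delta power_mult_distrib field_simps)
  then have \<sigma>_eq: "\<sigma> = inverse ((m * psi \<rho> s L)\<^sup>2)" by (metis inverse_inverse_eq)
  have \<sigma>: "0 < \<sigma>" and sqrt_\<sigma>: "sqrt \<sigma> = inverse (m * psi \<rho> s L)"
    using psi_s constants_pos by (auto simp: \<sigma>_eq real_sqrt_inverse)

  \<comment> \<open>The operators \<open>T\<close>, \<open>K\<close>, \<open>W\<close> and the
    affine majorant of \<open>W\<close>\<close>
  define T where "T = A o\<^sub>L op_power G s"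
  define K where "K = hadjoint T o\<^sub>L T"
  define W where "W = op_power G (p - s)"
  note saK = selfadjoint_gram[OF K_def] and specK = spectrum_gram[OF K_def]
  have cont_g: "continuous_on (op_spectrum K) (g_fun \<alpha> n)"
    and cont_r: "continuous_on (op_spectrum K) (residual_fun \<alpha> n)"
    using continuous_on_g_fun[of n \<alpha>] continuous_on_residual_fun[of n \<alpha>] alpha_pos specK
    by (auto elim: continuous_on_subset)
  have contW: "continuous_on (op_spectrum G) (real_power (p - s))"
    and conts: "continuous_on (op_spectrum G) (real_power s)"
    using s_p by (auto intro: continuous_on_subset[OF continuous_on_real_power specG'])
  have cont\<rho>: "continuous_on (op_spectrum G) (extend0 \<rho>)"
    and cont\<psi>: "continuous_on (op_spectrum G) (\<lambda>t. extend0 \<rho> t * real_power s t)"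
    using continuous_on_extend0[OF rho_index] continuous_on_psi_extended[OF rho_index s_p(1)] specG
    by (auto elim: continuous_on_subset)
  have link_T: "m * norm (op_fun (extend0 \<rho>) G (op_power G s x)) \<le> norm (T x)" for x
    using link by (simp add: T_def)

  \<comment> \<open>The scalar bound is applied to \<open>G\<close>, then the link condition trades
    \<open>psi \<rho> s\<close> of \<open>G\<close> for \<open>T\<close>; the factor
    \<open>1 / (m * psi \<rho> s L)\<^sup>2\<close> that appears is exactly
    \<open>\<sigma>\<close>.\<close>
  have W_bound: "(norm (W x))\<^sup>2 \<le> h\<^sup>2 * ((norm x)\<^sup>2 + \<sigma> * (norm (T x))\<^sup>2)" for x
  proof -
    have "(norm (W x))\<^sup>2
        \<le> op_fun (\<lambda>t. h\<^sup>2 + (h / psi \<rho> s L)\<^sup>2 * (extend0 \<rho> t * real_power s t)\<^sup>2) G x \<bullet> x"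
      unfolding W_def op_power_eq
    proof (intro norm_op_fun_power2_le[OF saG contW] continuous_on_add continuous_on_mult
        continuous_on_power continuous_on_const cont\<rho> conts)
      fix t assume "t \<in> op_spectrum G"
      with specG have "0 \<le> t" "t \<le> a" by auto
      from source_index_bound[OF rho_index s_p h_decreasing L this]
      show "(real_power (p - s) t)\<^sup>2
          \<le> h\<^sup>2 + (h / psi \<rho> s L)\<^sup>2 * (extend0 \<rho> t * real_power s t)\<^sup>2"
        unfolding h_def .
    qed
    also have "\<dots> = h\<^sup>2 * (norm x)\<^sup>2
        + (h / psi \<rho> s L)\<^sup>2 * (norm (op_fun (extend0 \<rho>) G (op_power G s x)))\<^sup>2"
      using norm_op_fun_power2[OF saG cont\<psi>, of x]
      by (simp add: op_fun_add[OF saG] op_fun_cmult[OF saG] op_fun_const[OF saG] continuous_on_power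
          cont\<psi> continuous_on_mult continuous_on_const blinfun.bilinear_simps inner_add_left
          op_fun_mult[OF saG cont\<rho> conts] op_power_eq power2_norm_eq_inner[of x])
    also have "(h / psi \<rho> s L)\<^sup>2 * (norm (op_fun (extend0 \<rho>) G (op_power G s x)))\<^sup>2
        = h\<^sup>2 * \<sigma> * (m * norm (op_fun (extend0 \<rho>) G (op_power G s x)))\<^sup>2"
      using psi_s constants_pos by (simp add: \<sigma>_eq power_mult_distrib power_divide field_simps)
    also have "\<dots> \<le> h\<^sup>2 * \<sigma> * (norm (T x))\<^sup>2"
      using \<sigma> constants_pos by (intro mult_left_mono power_mono link_T) auto
    finally show ?thesis by (simp add: algebra_simps)
  qed

  \<comment> \<open>Propagated noise \<open>q\<^sub>1\<close> and approximation error
    \<open>q\<^sub>2\<close>\<close>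
  define q\<^sub>1 where "q\<^sub>1 = op_fun (g_fun \<alpha> n) K (hadjoint T (y\<^sub>\<delta> - y))"
  define q\<^sub>2 where "q\<^sub>2 = op_fun (residual_fun \<alpha> n) K (W v)"
  have noise': "norm (y\<^sub>\<delta> - y) \<le> \<delta>" using noise by (simp add: norm_minus_commute)
  have g_bounds: "0 \<le> g_fun \<alpha> n t \<and> g_fun \<alpha> n t \<le> \<sigma> \<and> t * g_fun \<alpha> n t \<le> 1" if "0 \<le> t" for t
    using g_fun_bounds[of n \<alpha> t] g_fun_residual[of n \<alpha> t] residual_fun_pos[of n \<alpha> t] alpha_pos that
    by (simp add: \<sigma>_def less_imp_le)
  have r_bounds: "0 \<le> residual_fun \<alpha> n t \<and> residual_fun \<alpha> n t * (1 + \<sigma> * t) \<le> 1" if "0 \<le> t" for t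
    using residual_fun_bound[of n \<alpha> t] residual_fun_pos[of n \<alpha> t] alpha_pos that
    by (simp add: \<sigma>_def less_imp_le)
  note data = data_error_bound[OF K_def cont_g g_bounds, of "y\<^sub>\<delta> - y", folded q\<^sub>1_def]
  have saW: "selfadjoint_bounded W"
    unfolding W_def op_power_eq by (rule selfadjoint_op_fun[OF saG contW])
  note approx = approximation_error_bound[OF K_def cont_r r_bounds \<sigma> less_imp_le[OF h] saW W_bound,
      of v, folded q\<^sub>2_def]
  \<comment> \<open>The parameter choice balances the errors:
    \<open>sqrt \<sigma> * \<delta> = E * h\<close>, so \<open>q\<^sub>1\<close> and
    \<open>q\<^sub>2\<close> obey the same two bounds.\<close>
  have "norm q\<^sub>1 \<le> sqrt \<sigma> * \<delta>"
    using data(1) noise' \<sigma> by (meson mult_left_mono order_trans real_sqrt_ge_zero less_imp_le)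
  also have "\<dots> = E * h"
    using psi_s constants_pos by (simp add: sqrt_\<sigma> delta field_simps)
  finally have q1: "norm q\<^sub>1 \<le> E * h" .
  have hv: "h * norm v \<le> E * h" using source(2) h by (simp add: mult.commute)
  have q2: "norm q\<^sub>2 \<le> E * h" using approx(1) hv by (rule order_trans)
  have Tq1: "norm (T q\<^sub>1) \<le> \<delta>" using data(2) noise' by (rule order_trans)
  have "sqrt \<sigma> * norm (T q\<^sub>2) \<le> E * h" using approx(2) hv by (rule order_trans)
  then have Tq2: "norm (T q\<^sub>2) \<le> \<delta>"
    using psi_s constants_pos by (simp add: sqrt_\<sigma> delta field_simps)

  \<comment> \<open>Interpolation between the bounds on \<open>z\<close> and on
    \<open>T z\<close>\<close>
  define z where "z = q\<^sub>1 - q\<^sub>2"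
  have z: "norm z \<le> 2 * E * h"
    using norm_triangle_ineq4[of q\<^sub>1 q\<^sub>2] q1 q2 by (simp add: z_def)
  have "norm (T z) \<le> 2 * \<delta>"
    using norm_triangle_ineq4[of "T q\<^sub>1" "T q\<^sub>2"] Tq1 Tq2 by (simp add: z_def blinfun.diff_right)
  with link_T[of z] have "m * norm (op_fun (extend0 \<rho>) G (op_power G s z)) \<le> 2 * \<delta>"
    by (rule order_trans)
  then have Gz: "norm (op_fun (extend0 \<rho>) G (op_power G s z)) \<le> 2 * E * h * psi \<rho> s L"
    using constants_pos by (simp add: delta field_simps)
  have bound: "norm (op_power G s z) \<le> 2 * E * h * L powr s"
    by (rule interpolation[OF rho_index saG specG s_p(1) L xi_convex z Gz])

  \<comment> \<open>Identification of the error with \<open>op_power G s z\<close>\<close>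
  have source': "xdag - x\<^sub>0 = op_power G s (W v)"
    using op_power_add[OF saG specG', of s "p - s"] s_p source(1) by (simp add: W_def)
  have "A xdag - A x\<^sub>0 = T (W v)"
    by (simp add: T_def source'[symmetric] blinfun.diff_right)
  then have "y\<^sub>\<delta> - A x\<^sub>0 = (y\<^sub>\<delta> - y) + T (W v)"
    using exact_solution by (simp add: algebra_simps)
  then have "op_fun (g_fun \<alpha> n) K (hadjoint T (y\<^sub>\<delta> - A x\<^sub>0)) = q\<^sub>1 + op_fun (g_fun \<alpha> n) K (K (W v))"
    unfolding q\<^sub>1_def by (simp only: blinfun.add_right K_def blinfun_apply_blinfun_compose)
  also have "op_fun (g_fun \<alpha> n) K (K (W v)) = op_fun (\<lambda>t. g_fun \<alpha> n t * t) K (W v)"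
    by (simp add: op_fun_mult[OF saK cont_g continuous_on_id] op_fun_ident[OF saK])
  \<comment> \<open>Exact data pass through \<open>g(K) K = 1 - r(K)\<close>;
    \<open>g_fun_residual\<close> applies because the spectrum of \<open>K\<close> is nonnegative.
    The summand \<open>W v\<close> left over cancels against \<open>xdag - x\<^sub>0\<close> once
    \<open>op_power G s\<close> is applied.\<close>
  also have "op_fun (\<lambda>t. g_fun \<alpha> n t * t) K = op_fun (\<lambda>t. 1 + (- 1) * residual_fun \<alpha> n t) K"
  proof (rule op_fun_cong[OF saK])
    show "continuous_on (op_spectrum K) (\<lambda>t. g_fun \<alpha> n t * t)"
      by (intro continuous_on_mult cont_g continuous_on_id)
    show "g_fun \<alpha> n t * t = 1 + (- 1) * residual_fun \<alpha> n t" if "t \<in> op_spectrum K" for t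
      using g_fun_residual[of n \<alpha> t] alpha_pos specK that by (auto simp: mult.commute)
  qed
  also have "op_fun (\<lambda>t. 1 + (- 1) * residual_fun \<alpha> n t) K (W v) = W v - q\<^sub>2"
    unfolding q\<^sub>2_def
    by (subst op_fun_add[OF saK] op_fun_cmult[OF saK] op_fun_const[OF saK],
        (intro continuous_intros cont_r)+)+
       (simp add: op_fun_const[OF saK] blinfun.bilinear_simps)
  also have "q\<^sub>1 + (W v - q\<^sub>2) = z + W v" by (simp add: z_def)
  finally have "regularized_solution A G s \<alpha> n x\<^sub>0 y\<^sub>\<delta> = x\<^sub>0 + op_power G s (z + W v)"
    by (simp add: regularized_solution_def Let_def T_def[symmetric] K_def[symmetric])
  then have "regularized_solution A G s \<alpha> n x\<^sub>0 y\<^sub>\<delta> - xdag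
      = op_power G s (z + W v) - (xdag - x\<^sub>0)"
    by simp
  also have "\<dots> = op_power G s z"
    unfolding source' by (simp add: blinfun.add_right)
  finally show ?thesis
    using bound by (simp add: psi_inv Lp mult.assoc)
qed

end
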